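(* Let $G$ be the directed $2$-cycle, so that $V(G)=\{x,y\}$ and $E(G)=\{e,f\}$, where $s(e)=r(f)=x$ and $s(f)=r(e)=y$. Let $\lambda$ be any left-bounded left weight on $G$ with right companion $\rho$, and let $G^+_\rho=\{u\in G^+:\rho(u)<\infty\}$. Then $\mathfrak{L}(G,\lambda)''=\mathfrak{L}(G,\lambda)$ if and only if for every $v\in G^+$ there exists $u_v\in G^+_\rho$ such that $vu_v\in G^+_\rho$.
   Context: For a directed graph $G$ with vertex set $V(G)$ and edge set $E(G)$, $G^+$ is the set of all finite directed paths in $G$, including the vertices as paths of length $0$; $s(w)$, $r(w)$ are the source and range vertices of a path $w$, with $s(z)=r(z)=z$ for $z\in V(G)$. Paths are composed right to left: $w=r(w)\,w\,s(w)$, and for $v,w\in G^+$ one has $wv\in G^+$ if and only if $s(w)=r(v)$. $\mathcal{H}_G=\ell^2(G^+)$ with canonical orthonormal basis $\{\xi_v : v\in G^+\}$; commutants are taken in $\mathcal{B}(\mathcal{H}_G)$. A left weight on $G$ is a function $\lambda: G^+\times G^+\to[0,\infty)$ such that $\lambda(v,w)>0\iff wv\in G^+$, and $\lambda(v,w_2w_1)=\lambda(w_1v,w_2)\lambda(v,w_1)$ whenever $w_2w_1v\in G^+$. Put $\lambda(w)=\sup_{v\in G^+}\lambda(v,w)\in[0,\infty]$. $\lambda$ is left-bounded if $\lambda(w)<\infty$ for all $w\in G^+$. If $\lambda(w)<\infty$, $L_{\lambda,w}\in\mathcal{B}(\mathcal{H}_G)$ is the bounded operator with $L_{\lambda,w}\xi_v=\lambda(v,w)\xi_{wv}$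 if $wv\in G^+$ and $L_{\lambda,w}\xi_v=0$ otherwise. $\mathfrak{L}(G,\lambda)$ is the WOT-closed unital operator algebra generated by $\{L_{\lambda,w}: w\in G^+,\ \lambda(w)<\infty\}$. A right weight on $G$ is a function $\rho:G^+\times G^+\to[0,\infty)$ such that $\rho(v,u)>0\iff vu\in G^+$, and $\rho(v,u_1u_2)=\rho(vu_1,u_2)\rho(v,u_1)$ whenever $vu_1u_2\in G^+$. Put $\rho(u)=\sup_{v\in G^+}\rho(v,u)\in[0,\infty]$. A right weight $\rho$ is a right companion to $\lambda$ if $\rho(wv,u)\lambda(v,w)=\lambda(vu,w)\rho(v,u)$ for all $v,w,u\in G^+$ with $wvu\in G^+$. *)

theory Defs
  imports "HOL-Analysis.Analysis" "Graph_Theory.Arc_Walk"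
begin

section \<open>Finite directed paths\<close>

text \<open>
  A path is a triple (source, arcs, range), the arcs being listed in the order of traversal,
  as in \<^const>\<open>pre_digraph.awalk\<close>.  The product \<open>w \<odot> v\<close> means ``first \<open>v\<close>, then \<open>w\<close>'', so the arc
  lists appear in the opposite order.
\<close>

type_synonym ('v, 'e) dpath = "'v \<times> 'e list \<times> 'v"

definition dpaths :: "('v, 'e) pre_digraph \<Rightarrow> ('v, 'e) dpath set" where
  "dpaths G = {(a, p, b). pre_digraph.awalk G a p b}"

definition src :: "('v, 'e) dpath \<Rightarrow> 'v" where
  "src w = fst w"

definition rng :: "('v, 'e) dpath \<Rightarrow> 'v" where
  "rng w = snd (snd w)"

definition pcomp :: "('v, 'e) dpath \<Rightarrow> ('v, 'e) dpath \<Rightarrow> ('v, 'e) dpath"  (infixr \<open>\<odot>\<close> 75) where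
  "w \<odot> v = (src v, fst (snd v) @ fst (snd w), rng w)"

text \<open>For paths, membership of the formal product in \<^const>\<open>dpaths\<close> is composability.\<close>

lemma pcomp_in_dpaths_iff:
  assumes "w \<in> dpaths G" "v \<in> dpaths G"
  shows "w \<odot> v \<in> dpaths G \<longleftrightarrow> src w = rng v"
proof -
  obtain a p b where v: "v = (a, p, b)" by (cases v)
  obtain c q d where w: "w = (c, q, d)" by (cases w)
  have cas_unique: "b1 = b2"
    if "pre_digraph.cas G a1 p1 b1" "pre_digraph.cas G a1 p1 b2" for a1 b1 b2 p1
    using that by (induction p1 arbitrary: a1) (auto simp: pre_digraph.cas.simps)
  have cas_unique': "a1 = a2"
    if "pre_digraph.cas G a1 p1 b1" "pre_digraph.cas G a2 p1 b1" for a1 a2 b1 p1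
    using that by (cases p1) (auto simp: pre_digraph.cas.simps)
  have app: "pre_digraph.cas G a (p @ q) d \<longleftrightarrow>
      (\<exists>m. pre_digraph.cas G a p m \<and> pre_digraph.cas G m q d)" for a
    by (induction p arbitrary: a) (auto simp: pre_digraph.cas.simps)
  from assms show ?thesis
    unfolding v w dpaths_def pcomp_def src_def rng_def
    by (auto simp: pre_digraph.awalk_def app dest: cas_unique cas_unique')
qed

lemma pcomp_assoc: "(w2 \<odot> w1) \<odot> v = w2 \<odot> (w1 \<odot> v)"
  by (simp add: pcomp_def src_def rng_def)

lemma pcomp_cancel_left:
  assumes "v \<in> dpaths G" "v' \<in> dpaths G" "w \<in> dpaths G" "w \<odot> v \<in> dpaths G"
    and eq: "w \<odot> v = w \<odot> v'"
  shows "v = v'"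
proof -
  have "rng v = rng v'"
    using assms pcomp_in_dpaths_iff by metis
  with eq show ?thesis
    by (auto simp: pcomp_def src_def rng_def prod_eq_iff)
qed


section \<open>Square-summable families and bounded operators\<close>

text \<open>
  The space \<open>l2 I\<close> consists of functions on the whole index type that vanish off \<open>I\<close>; operators on it
  are extensional functions, so that equality of operators is equality on \<open>l2 I\<close>.
\<close>

definition l2 :: "'i set \<Rightarrow> ('i \<Rightarrow> complex) set" where
  "l2 I = {f. (\<forall>i. i \<notin> I \<longrightarrow> f i = 0) \<and> (\<lambda>i. (cmod (f i))\<^sup>2) summable_on I}"

definition l2_inner :: "'i set \<Rightarrow> ('i \<Rightarrow> complex) \<Rightarrow> ('i \<Rightarrow> complex) \<Rightarrow> complex" where
  "l2_inner I f g = (\<Sum>\<^sub>\<infinity>i\<in>I. f i * cnj (g i))"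

definition l2_norm :: "'i set \<Rightarrow> ('i \<Rightarrow> complex) \<Rightarrow> real" where
  "l2_norm I f = sqrt (\<Sum>\<^sub>\<infinity>i\<in>I. (cmod (f i))\<^sup>2)"

definition basis_vec :: "'i \<Rightarrow> 'i \<Rightarrow> complex"  (\<open>\<xi>\<close>) where
  "\<xi> v = (\<lambda>i. if i = v then 1 else 0)"

type_synonym 'i op = "('i \<Rightarrow> complex) \<Rightarrow> 'i \<Rightarrow> complex"

definition bounded_ops :: "'i set \<Rightarrow> 'i op set" where
  "bounded_ops I = {T \<in> l2 I \<rightarrow>\<^sub>E l2 I.
     (\<forall>f\<in>l2 I. \<forall>g\<in>l2 I. T (\<lambda>i. f i + g i) = (\<lambda>i. T f i + T g i)) \<and>
     (\<forall>c. \<forall>f\<in>l2 I. T (\<lambda>i. c * f i) = (\<lambda>i. c * T f i)) \<and>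
     (\<exists>K. \<forall>f\<in>l2 I. l2_norm I (T f) \<le> K * l2_norm I f)}"

definition op_id :: "'i set \<Rightarrow> 'i op" where
  "op_id I = (\<lambda>f\<in>l2 I. f)"

definition op_add :: "'i set \<Rightarrow> 'i op \<Rightarrow> 'i op \<Rightarrow> 'i op" where
  "op_add I S T = (\<lambda>f\<in>l2 I. \<lambda>i. S f i + T f i)"

definition op_scale :: "'i set \<Rightarrow> complex \<Rightarrow> 'i op \<Rightarrow> 'i op" where
  "op_scale I c T = (\<lambda>f\<in>l2 I. \<lambda>i. c * T f i)"

definition op_mult :: "'i set \<Rightarrow> 'i op \<Rightarrow> 'i op \<Rightarrow> 'i op" where
  "op_mult I S T = compose (l2 I) S T"

definition commutant :: "'i set \<Rightarrow> 'i op set \<Rightarrow> 'i op set" where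
  "commutant I \<S> = {T \<in> bounded_ops I. \<forall>S\<in>\<S>. op_mult I T S = op_mult I S T}"

definition unital_operator_algebra :: "'i set \<Rightarrow> 'i op set \<Rightarrow> bool" where
  "unital_operator_algebra I \<A> \<longleftrightarrow>
     \<A> \<subseteq> bounded_ops I \<and> op_id I \<in> \<A> \<and>
     (\<forall>S\<in>\<A>. \<forall>T\<in>\<A>. op_add I S T \<in> \<A>) \<and>
     (\<forall>c. \<forall>T\<in>\<A>. op_scale I c T \<in> \<A>) \<and>
     (\<forall>S\<in>\<A>. \<forall>T\<in>\<A>. op_mult I S T \<in> \<A>)"

text \<open>
  The weak operator topology: the coarsest topology on \<^term>\<open>bounded_ops I\<close> for which all
  maps \<open>T \<mapsto> \<langle>T f, g\<rangle>\<close> with \<open>f\<close>, \<open>g\<close> in \<open>l2 I\<close> are continuous.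
\<close>

definition weak_operator_topology_on :: "'i set \<Rightarrow> 'i op topology" where
  "weak_operator_topology_on I =
     pullback_topology (bounded_ops I)
       (\<lambda>T. \<lambda>(f, g)\<in>l2 I \<times> l2 I. l2_inner I (T f) g)
       (product_topology (\<lambda>_. euclidean) (l2 I \<times> l2 I))"

lemma topspace_weak_operator_topology_on [simp]:
  "topspace (weak_operator_topology_on I) = bounded_ops I"
  by (auto simp: weak_operator_topology_on_def topspace_pullback_topology)

definition wot_closed_algebra_generated :: "'i set \<Rightarrow> 'i op set \<Rightarrow> 'i op set" where
  "wot_closed_algebra_generated I \<S> =
     (\<lambda>\<A>. unital_operator_algebra I \<A> \<and> closedin (weak_operator_topology_on I) \<A>) hull \<S>"


section \<open>Weights\<close>

type_synonym ('v, 'e) weight = "('v, 'e) dpath \<Rightarrow> ('v, 'e) dpath \<Rightarrow> real"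

definition left_weight :: "('v, 'e) pre_digraph \<Rightarrow> ('v, 'e) weight \<Rightarrow> bool" where
  "left_weight G lam \<longleftrightarrow>
     (\<forall>v\<in>dpaths G. \<forall>w\<in>dpaths G. 0 \<le> lam v w \<and> (0 < lam v w \<longleftrightarrow> w \<odot> v \<in> dpaths G)) \<and>
     (\<forall>v\<in>dpaths G. \<forall>w1\<in>dpaths G. \<forall>w2\<in>dpaths G. w2 \<odot> w1 \<odot> v \<in> dpaths G \<longrightarrow>
        lam v (w2 \<odot> w1) = lam (w1 \<odot> v) w2 * lam v w1)"

definition right_weight :: "('v, 'e) pre_digraph \<Rightarrow> ('v, 'e) weight \<Rightarrow> bool" where
  "right_weight G rho \<longleftrightarrow>
     (\<forall>v\<in>dpaths G. \<forall>u\<in>dpaths G. 0 \<le> rho v u \<and> (0 < rho v u \<longleftrightarrow> v \<odot> u \<in> dpaths G)) \<and>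
     (\<forall>v\<in>dpaths G. \<forall>u1\<in>dpaths G. \<forall>u2\<in>dpaths G. v \<odot> u1 \<odot> u2 \<in> dpaths G \<longrightarrow>
        rho v (u1 \<odot> u2) = rho (v \<odot> u1) u2 * rho v u1)"

definition weight_sup :: "('v, 'e) pre_digraph \<Rightarrow> ('v, 'e) weight \<Rightarrow> ('v, 'e) dpath \<Rightarrow> ereal" where
  "weight_sup G lam w = (SUP v\<in>dpaths G. ereal (lam v w))"

definition finite_weight_paths :: "('v, 'e) pre_digraph \<Rightarrow> ('v, 'e) weight \<Rightarrow> ('v, 'e) dpath set" where
  "finite_weight_paths G lam = {w \<in> dpaths G. weight_sup G lam w < \<infinity>}"

definition left_bounded :: "('v, 'e) pre_digraph \<Rightarrow> ('v, 'e) weight \<Rightarrow> bool" where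
  "left_bounded G lam \<longleftrightarrow> (\<forall>w\<in>dpaths G. weight_sup G lam w < \<infinity>)"

definition right_companion ::
  "('v, 'e) pre_digraph \<Rightarrow> ('v, 'e) weight \<Rightarrow> ('v, 'e) weight \<Rightarrow> bool" where
  "right_companion G lam rho \<longleftrightarrow> right_weight G rho \<and>
     (\<forall>v\<in>dpaths G. \<forall>w\<in>dpaths G. \<forall>u\<in>dpaths G. w \<odot> v \<odot> u \<in> dpaths G \<longrightarrow>
        rho (w \<odot> v) u * lam v w = lam (v \<odot> u) w * rho v u)"


section \<open>The weighted left creation operators and their algebra\<close>

text \<open>
  The linear extension of \<open>\<xi> v \<mapsto> \<lambda>(v, w) \<xi> (w \<odot> v)\<close>.  By left cancellation the sum below has at
  most one term; see \<open>weighted_shift_basis\<close> and \<open>weighted_shift_bounded\<close>.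
\<close>

definition weighted_shift ::
  "('v, 'e) pre_digraph \<Rightarrow> ('v, 'e) weight \<Rightarrow> ('v, 'e) dpath \<Rightarrow> ('v, 'e) dpath op" where
  "weighted_shift G lam w = (\<lambda>f\<in>l2 (dpaths G). \<lambda>u.
     if u \<in> dpaths G then \<Sum>v | v \<in> dpaths G \<and> w \<odot> v = u. complex_of_real (lam v w) * f v else 0)"

lemma basis_vec_in_l2:
  assumes "v \<in> I"
  shows "\<xi> v \<in> l2 I"
proof -
  have "(\<lambda>i. (cmod (\<xi> v i))\<^sup>2) summable_on I \<longleftrightarrow> (\<lambda>i. (cmod (\<xi> v i))\<^sup>2) summable_on {v}"
    by (rule summable_on_cong_neutral) (use assms in \<open>auto simp: basis_vec_def\<close>)
  then show ?thesis
    using assms by (auto simp: l2_def basis_vec_def)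
qed

lemma weighted_shift_pcomp:
  assumes "f \<in> l2 (dpaths G)" "v \<in> dpaths G" "w \<in> dpaths G" "w \<odot> v \<in> dpaths G"
  shows "weighted_shift G lam w f (w \<odot> v) = complex_of_real (lam v w) * f v"
proof -
  have "{v'. v' \<in> dpaths G \<and> w \<odot> v' = w \<odot> v} = {v}"
  proof (intro set_eqI iffI)
    fix v' assume "v' \<in> {v'. v' \<in> dpaths G \<and> w \<odot> v' = w \<odot> v}"
    then have "v' \<in> dpaths G" "w \<odot> v = w \<odot> v'" by simp_all
    then show "v' \<in> {v}"
      using pcomp_cancel_left[OF assms(2) _ assms(3,4)] by simp
  qed (use assms(2) in simp)
  then show ?thesis
    unfolding weighted_shift_def restrict_apply if_P[OF assms(1)] if_P[OF assms(4)] by simp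
qed

lemma weighted_shift_eq_0:
  assumes "f \<in> l2 (dpaths G)" "\<nexists>v. v \<in> dpaths G \<and> w \<odot> v = u \<and> u \<in> dpaths G"
  shows "weighted_shift G lam w f u = 0"
  unfolding weighted_shift_def using assms by (auto intro!: sum.neutral)

lemma weighted_shift_basis:
  assumes "v \<in> dpaths G" "w \<in> dpaths G"
  shows "weighted_shift G lam w (\<xi> v) =
    (if w \<odot> v \<in> dpaths G then (\<lambda>u. complex_of_real (lam v w) * \<xi> (w \<odot> v) u) else (\<lambda>_. 0))"
proof (rule ext)
  fix u
  note b = basis_vec_in_l2[OF assms(1)]
  show "weighted_shift G lam w (\<xi> v) u =
    (if w \<odot> v \<in> dpaths G then (\<lambda>u. complex_of_real (lam v w) * \<xi> (w \<odot> v) u) else (\<lambda>_. 0)) u"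
  proof (cases "\<exists>v'. v' \<in> dpaths G \<and> w \<odot> v' = u \<and> u \<in> dpaths G")
    case True
    then obtain v' where v': "v' \<in> dpaths G" "w \<odot> v' = u" "w \<odot> v' \<in> dpaths G" by auto
    have "w \<odot> v' = w \<odot> v \<longleftrightarrow> v = v'"
      using pcomp_cancel_left[OF v'(1) assms v'(3)] by auto
    with v' weighted_shift_pcomp[OF b v'(1) assms(2) v'(3), of lam] show ?thesis
      by (auto simp: basis_vec_def)
  next
    case False
    then have "u \<noteq> w \<odot> v" if "w \<odot> v \<in> dpaths G"
      using that assms(1) by blast
    with weighted_shift_eq_0[OF b False] show ?thesis
      by (simp add: basis_vec_def)
  qed
qed

lemma weighted_shift_bounded:
  assumes lw: "left_weight G lam" and w: "w \<in> finite_weight_paths G lam"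
  shows "weighted_shift G lam w \<in> bounded_ops (dpaths G)"
proof -
  let ?P = "dpaths G" and ?L = "weighted_shift G lam w"
  define D where "D = {v \<in> ?P. w \<odot> v \<in> ?P}"
  have wP: "w \<in> ?P" and fin: "weight_sup G lam w < \<infinity>"
    using w by (auto simp: finite_weight_paths_def)
  obtain c where c: "lam v w \<le> c" if "v \<in> ?P" for v
  proof (cases "weight_sup G lam w")
    case (real r)
    have "lam v w \<le> r" if "v \<in> ?P" for v
      using SUP_upper[OF that, of "\<lambda>v. ereal (lam v w)"] real by (simp add: weight_sup_def)
    then show ?thesis using that by blast
  next
    case PInf
    then show ?thesis using fin by simp
  next
    case MInf
    have "ereal (lam w w) \<le> weight_sup G lam w"
      unfolding weight_sup_def using wP by (rule SUP_upper)
    then show ?thesis using MInf by simp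
  qed
  have nn: "0 \<le> lam v w" if "v \<in> ?P" for v
    using lw wP that unfolding left_weight_def by blast
  have inj: "inj_on ((\<odot>) w) D"
    using pcomp_cancel_left[OF _ _ wP] unfolding D_def inj_on_def by blast
  have supp: "?L f u = 0" if "f \<in> l2 ?P" "u \<notin> (\<odot>) w ` D" for f u
    by (rule weighted_shift_eq_0[OF that(1)]) (use that(2) in \<open>auto simp: D_def\<close>)
  have val: "?L f (w \<odot> v) = complex_of_real (lam v w) * f v" if "f \<in> l2 ?P" "v \<in> D" for f v
    using that wP by (intro weighted_shift_pcomp) (auto simp: D_def)
  have le: "(cmod (?L f (w \<odot> v)))\<^sup>2 \<le> c\<^sup>2 * (cmod (f v))\<^sup>2" if "f \<in> l2 ?P" "v \<in> D" for f v
  proof -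
    have "v \<in> ?P" using that by (simp add: D_def)
    then have "(lam v w)\<^sup>2 \<le> c\<^sup>2" using c nn by (intro power_mono) auto
    then show ?thesis
      using val[OF that] by (simp add: norm_mult power_mult_distrib mult_right_mono)
  qed
  have smD: "(\<lambda>v. c\<^sup>2 * (cmod (f v))\<^sup>2) summable_on ?P" if "f \<in> l2 ?P" for f
    using that by (intro summable_on_cmult_right) (auto simp: l2_def)
  have D_sub: "D \<subseteq> ?P" by (auto simp: D_def)
  have sm: "(\<lambda>v. (cmod (?L f (w \<odot> v)))\<^sup>2) summable_on D" if "f \<in> l2 ?P" for f
    by (rule summable_on_comparison_test[OF summable_on_subset_banach[OF smD[OF that] D_sub]])
       (use le that in auto)
  have neutral1: "(\<lambda>u. (cmod (?L f u))\<^sup>2) summable_on ?P \<longleftrightarrow>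
      (\<lambda>u. (cmod (?L f u))\<^sup>2) summable_on (\<odot>) w ` D"
    if "f \<in> l2 ?P" for f
    by (rule summable_on_cong_neutral) (use supp that in \<open>auto simp: D_def\<close>)
  have neutral2: "(\<Sum>\<^sub>\<infinity>u\<in>?P. (cmod (?L f u))\<^sup>2) = (\<Sum>\<^sub>\<infinity>v\<in>D. (cmod (?L f (w \<odot> v)))\<^sup>2)"
    if "f \<in> l2 ?P" for f
  proof -
    have "(\<Sum>\<^sub>\<infinity>u\<in>?P. (cmod (?L f u))\<^sup>2) = (\<Sum>\<^sub>\<infinity>u\<in>(\<odot>) w ` D. (cmod (?L f u))\<^sup>2)"
      by (rule infsum_cong_neutral) (use supp that in \<open>auto simp: D_def\<close>)
    then show ?thesis
      by (simp add: infsum_reindex[OF inj] o_def)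
  qed
  have in_l2: "?L f \<in> l2 ?P" if "f \<in> l2 ?P" for f
  proof -
    have "(\<lambda>u. (cmod (?L f u))\<^sup>2) summable_on ?P"
      unfolding neutral1[OF that] summable_on_reindex[OF inj] using sm[OF that] by (simp add: o_def)
    moreover have "?L f u = 0" if "u \<notin> ?P" for u
      by (rule supp[OF \<open>f \<in> l2 ?P\<close>]) (use that in \<open>auto simp: D_def\<close>)
    ultimately show ?thesis by (simp add: l2_def)
  qed
  have bd: "l2_norm ?P (?L f) \<le> \<bar>c\<bar> * l2_norm ?P f" if f: "f \<in> l2 ?P" for f
  proof -
    have "(\<Sum>\<^sub>\<infinity>u\<in>?P. (cmod (?L f u))\<^sup>2) \<le> (\<Sum>\<^sub>\<infinity>v\<in>?P. c\<^sup>2 * (cmod (f v))\<^sup>2)"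
      unfolding neutral2[OF f]
      by (rule infsum_mono_neutral[OF sm[OF f] smD[OF f]]) (use le f D_sub in auto)
    also have "\<dots> = c\<^sup>2 * (\<Sum>\<^sub>\<infinity>v\<in>?P. (cmod (f v))\<^sup>2)"
      by (rule infsum_cmult_right')
    finally have "l2_norm ?P (?L f) \<le> sqrt (c\<^sup>2 * (\<Sum>\<^sub>\<infinity>v\<in>?P. (cmod (f v))\<^sup>2))"
      unfolding l2_norm_def by (rule real_sqrt_le_mono)
    then show ?thesis
      by (simp add: l2_norm_def real_sqrt_mult)
  qed
  have add_l2: "(\<lambda>i. f i + g i) \<in> l2 ?P" if "f \<in> l2 ?P" "g \<in> l2 ?P" for f g
  proof -
    have "(\<lambda>i. 2 * (cmod (f i))\<^sup>2 + 2 * (cmod (g i))\<^sup>2) summable_on ?P"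
      using that by (intro summable_on_add summable_on_cmult_right) (auto simp: l2_def)
    moreover have "(cmod (f i + g i))\<^sup>2 \<le> 2 * (cmod (f i))\<^sup>2 + 2 * (cmod (g i))\<^sup>2" for i
    proof -
      have "(cmod (f i + g i))\<^sup>2 \<le> (cmod (f i) + cmod (g i))\<^sup>2"
        by (intro power_mono norm_triangle_ineq) auto
      also have "\<dots> \<le> 2 * (cmod (f i))\<^sup>2 + 2 * (cmod (g i))\<^sup>2"
        using sum_squares_bound[of "cmod (f i)" "cmod (g i)"] by (simp add: power2_sum)
      finally show ?thesis .
    qed
    ultimately have "(\<lambda>i. (cmod (f i + g i))\<^sup>2) summable_on ?P"
      by (rule summable_on_comparison_test) auto
    with that show ?thesis by (auto simp: l2_def)
  qed
  have scale_l2: "(\<lambda>i. a * f i) \<in> l2 ?P" if "f \<in> l2 ?P" for f a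
    using that by (auto simp: l2_def norm_mult power_mult_distrib intro!: summable_on_cmult_right)
  have "?L \<in> l2 ?P \<rightarrow>\<^sub>E l2 ?P"
    using in_l2 by (auto simp: PiE_def weighted_shift_def extensional_def)
  moreover have "?L (\<lambda>i. f i + g i) = (\<lambda>i. ?L f i + ?L g i)" if "f \<in> l2 ?P" "g \<in> l2 ?P" for f g
    using that add_l2[OF that] by (auto simp: weighted_shift_def ring_distribs sum.distrib)
  moreover have "?L (\<lambda>i. a * f i) = (\<lambda>i. a * ?L f i)" if "f \<in> l2 ?P" for f a
    using that scale_l2[OF that] by (auto simp: weighted_shift_def sum_distrib_left mult_ac)
  moreover have "\<exists>K. \<forall>f\<in>l2 ?P. l2_norm ?P (?L f) \<le> K * l2_norm ?P f"
    using bd by blast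
  ultimately show ?thesis
    unfolding bounded_ops_def by blast
qed

definition weighted_graph_algebra ::
  "('v, 'e) pre_digraph \<Rightarrow> ('v, 'e) weight \<Rightarrow> ('v, 'e) dpath op set"  (\<open>\<LL>\<close>) where
  "\<LL> G lam = wot_closed_algebra_generated (dpaths G)
     (weighted_shift G lam ` finite_weight_paths G lam)"

end

(*
  Let R_u be the weighted right shift of a path u with \<rho>(u) < \<infinity>; the companion identity makes it
  commute with the algebra.

  If u and vu both have finite right weight, an operator A in the double commutant commutes with R_u
  and R_(vu), and this forces A \<xi>_v = \<Sum>_w a_w \<lambda>(v, w) \<xi>_(wv) with coefficients a_w that do not depend on v.
  The Fejer means of A with respect to the path length are then finite combinations of the L_w; they
  are uniformly bounded and converge to A entrywise, hence weakly, so A lies in the algebra.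

  Conversely, a nonzero entry of an element of the commutant at (v, z) yields u with z = vu and
  \<rho>(u) < \<infinity>.  The projection onto the paths starting at x is not in the algebra, because the diagonal
  entries of an element of the algebra at a path and at its range vertex agree.  If it is not in the
  double commutant either, some u with distinct end points has \<rho>(u) < \<infinity>.  In the two-cycle all
  closed paths have finite right weight, so one such u serves all paths v.
*)
theory Submission
  imports Defs
begin

section \<open>Bounded operators and their matrices\<close>

text \<open>Put the source vertex \<open>s\<close> of \<open>w\<close> in place of \<open>v\<close>.
  The companion identity then reads \<open>rho w u = rho s u * lam u w / lam s w\<close>, so finite
  right weight of \<open>u\<close> means that the quotients \<open>lam u w / lam s w\<close> are
  bounded in \<open>w\<close>. An operator commuting with all \<open>L w\<close> is determined by
  its values on the vertex vectors, and these same quotients are its entries at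
  \<open>(w, w \<odot> u)\<close> up to a constant. This is why a single nonzero entry suffices. The
  obstacle in the sufficiency is that \<open>v\<close> itself may have infinite right weight. Then
  no bounded right shift leads from the vertex \<open>rng v\<close> to \<open>v\<close>, and the
  condition provides a detour through the longer path \<open>v \<odot> u\<close>. The partial sums
  of the resulting series need not be uniformly bounded, which forces an averaging. The cycle enters
  through three facts: a path is determined by its source and length, there are only two vertices,
  and each is reachable from the other. The rest is done for finite digraphs.\<close>

lemma l2_finite_sum_le:
  assumes "f \<in> l2 I" "finite F" "F \<subseteq> I"
  shows "(\<Sum>i\<in>F. (cmod (f i))\<^sup>2) \<le> (l2_norm I f)\<^sup>2"
proof -
  have "(\<Sum>i\<in>F. (cmod (f i))\<^sup>2) \<le> (\<Sum>\<^sub>\<infinity>i\<in>I. (cmod (f i))\<^sup>2)"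
    using assms by (intro finite_sum_le_infsum) (auto simp: l2_def)
  then show ?thesis
    by (simp add: l2_norm_def infsum_nonneg)
qed

text \<open>The terms are nonnegative, so a bound on all finite partial sums gives membership and
  norm bound at once. Most norm estimates below are made on such finite sets \<open>F\<close>, where
  sums can be swapped and reindexed freely.\<close>

lemma l2_boundI:
  assumes "\<And>i. i \<notin> I \<Longrightarrow> f i = 0"
    and "\<And>F. finite F \<Longrightarrow> F \<subseteq> I \<Longrightarrow> (\<Sum>i\<in>F. (cmod (f i))\<^sup>2) \<le> B"
  shows "f \<in> l2 I" "(l2_norm I f)\<^sup>2 \<le> B"
proof -
  have s: "(\<lambda>i. (cmod (f i))\<^sup>2) summable_on I"
    by (rule nonneg_bdd_above_summable_on) (use assms(2) in \<open>auto intro!: bdd_aboveI[of _ B]\<close>)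
  then show "f \<in> l2 I"
    using assms(1) by (simp add: l2_def)
  show "(l2_norm I f)\<^sup>2 \<le> B"
    using infsum_le_finite_sums[OF s assms(2)] by (simp add: l2_norm_def infsum_nonneg)
qed

lemma l2_norm_has_sum:
  assumes "f \<in> l2 I"
  shows "((\<lambda>i. (cmod (f i))\<^sup>2) has_sum (l2_norm I f)\<^sup>2) I"
  using assms by (simp add: l2_def l2_norm_def infsum_nonneg has_sum_infsum)

lemma l2_norm_nonneg [simp]: "0 \<le> l2_norm I f"
  by (simp add: l2_norm_def infsum_nonneg)

lemma l2_outside: "f \<in> l2 I \<Longrightarrow> i \<notin> I \<Longrightarrow> f i = 0"
  by (simp add: l2_def)

lemma cmod_add_square_le: "(cmod (a + b))\<^sup>2 \<le> 2 * (cmod a)\<^sup>2 + 2 * (cmod b)\<^sup>2"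
proof -
  have "(cmod (a + b))\<^sup>2 \<le> (cmod a + cmod b)\<^sup>2"
    by (intro power_mono norm_triangle_ineq) auto
  then show ?thesis
    using sum_squares_bound[of "cmod a" "cmod b"] by (simp add: power2_sum)
qed

lemma l2_add:
  assumes "f \<in> l2 I" "g \<in> l2 I"
  shows "(\<lambda>i. f i + g i) \<in> l2 I"
    and "(l2_norm I (\<lambda>i. f i + g i))\<^sup>2 \<le> 2 * (l2_norm I f)\<^sup>2 + 2 * (l2_norm I g)\<^sup>2"
proof -
  have "(\<Sum>i\<in>F. (cmod (f i + g i))\<^sup>2) \<le> 2 * (l2_norm I f)\<^sup>2 + 2 * (l2_norm I g)\<^sup>2"
    if F: "finite F" "F \<subseteq> I" for F
  proof -
    have "(\<Sum>i\<in>F. (cmod (f i + g i))\<^sup>2) \<le> (\<Sum>i\<in>F. 2 * (cmod (f i))\<^sup>2 + 2 * (cmod (g i))\<^sup>2)"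
      by (intro sum_mono cmod_add_square_le)
    also have "\<dots> = 2 * (\<Sum>i\<in>F. (cmod (f i))\<^sup>2) + 2 * (\<Sum>i\<in>F. (cmod (g i))\<^sup>2)"
      by (simp add: sum.distrib sum_distrib_left)
    also have "\<dots> \<le> 2 * (l2_norm I f)\<^sup>2 + 2 * (l2_norm I g)\<^sup>2"
      using l2_finite_sum_le[OF assms(1) F] l2_finite_sum_le[OF assms(2) F] by simp
    finally show ?thesis .
  qed
  then show "(\<lambda>i. f i + g i) \<in> l2 I"
    and "(l2_norm I (\<lambda>i. f i + g i))\<^sup>2 \<le> 2 * (l2_norm I f)\<^sup>2 + 2 * (l2_norm I g)\<^sup>2"
    using l2_boundI[of I "\<lambda>i. f i + g i"] assms by (auto simp: l2_outside)
qed

lemma l2_scale: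
  assumes "f \<in> l2 I"
  shows "(\<lambda>i. c * f i) \<in> l2 I"
  using assms by (auto simp: l2_def norm_mult power_mult_distrib intro!: summable_on_cmult_right)

lemma l2_norm_scale: "l2_norm I (\<lambda>i. c * f i) = cmod c * l2_norm I f"
  by (simp add: l2_norm_def norm_mult power_mult_distrib infsum_cmult_right' real_sqrt_mult)

lemma l2_zero: "(\<lambda>_. 0) \<in> l2 I"
  by (simp add: l2_def)

text \<open>\<open>K\<close> bounds the square of the operator norm;
  \<open>bounded_ops_bound\<close> is the converse passage.\<close>

lemma bounded_opsI:
  assumes "T \<in> extensional (l2 I)"
    and "\<And>f g. f \<in> l2 I \<Longrightarrow> g \<in> l2 I \<Longrightarrow> T (\<lambda>i. f i + g i) = (\<lambda>i. T f i + T g i)"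
    and "\<And>c f. f \<in> l2 I \<Longrightarrow> T (\<lambda>i. c * f i) = (\<lambda>i. c * T f i)"
    and "\<And>f i. f \<in> l2 I \<Longrightarrow> i \<notin> I \<Longrightarrow> T f i = 0"
    and bd: "\<And>f F. f \<in> l2 I \<Longrightarrow> finite F \<Longrightarrow> F \<subseteq> I \<Longrightarrow>
      (\<Sum>i\<in>F. (cmod (T f i))\<^sup>2) \<le> K * (l2_norm I f)\<^sup>2"
  shows "T \<in> bounded_ops I"
proof -
  have "T f \<in> l2 I" if "f \<in> l2 I" for f
    by (rule l2_boundI(1)[OF assms(4)[OF that] bd[OF that]])
  moreover have "l2_norm I (T f) \<le> sqrt K * l2_norm I f" if "f \<in> l2 I" for f
  proof -
    have "(l2_norm I (T f))\<^sup>2 \<le> K * (l2_norm I f)\<^sup>2"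
      by (rule l2_boundI(2)[OF assms(4)[OF that] bd[OF that]])
    then have "sqrt ((l2_norm I (T f))\<^sup>2) \<le> sqrt (K * (l2_norm I f)\<^sup>2)"
      by (rule real_sqrt_le_mono)
    then show ?thesis
      by (simp add: real_sqrt_mult)
  qed
  ultimately show ?thesis
    using assms(1-3) unfolding bounded_ops_def PiE_def by (intro CollectI conjI ballI allI IntI funcsetI) auto
qed

lemma bounded_ops_bound:
  assumes "T \<in> bounded_ops I"
  obtains K where "0 \<le> K"
    "\<forall>f\<in>l2 I. \<forall>F. finite F \<longrightarrow> F \<subseteq> I \<longrightarrow> (\<Sum>i\<in>F. (cmod (T f i))\<^sup>2) \<le> K * (l2_norm I f)\<^sup>2"
proof -
  obtain K where K: "\<forall>f\<in>l2 I. l2_norm I (T f) \<le> K * l2_norm I f" and T: "\<And>f. f \<in> l2 I \<Longrightarrow> T f \<in> l2 I"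
    using assms unfolding bounded_ops_def by blast
  have "(\<Sum>i\<in>F. (cmod (T f i))\<^sup>2) \<le> K\<^sup>2 * (l2_norm I f)\<^sup>2" if "f \<in> l2 I" "finite F" "F \<subseteq> I" for f F
  proof -
    have "(\<Sum>i\<in>F. (cmod (T f i))\<^sup>2) \<le> (l2_norm I (T f))\<^sup>2"
      using l2_finite_sum_le T that by blast
    also have "\<dots> \<le> (K * l2_norm I f)\<^sup>2"
      using K that by (intro power_mono) auto
    finally show ?thesis by (simp add: power_mult_distrib)
  qed
  then show ?thesis using that[of "K\<^sup>2"] by simp
qed

lemma bounded_ops_in_l2: "T \<in> bounded_ops I \<Longrightarrow> f \<in> l2 I \<Longrightarrow> T f \<in> l2 I"
  by (auto simp: bounded_ops_def)

lemma bounded_ops_outside: "T \<in> bounded_ops I \<Longrightarrow> f \<in> l2 I \<Longrightarrow> i \<notin> I \<Longrightarrow> T f i = 0"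
  using l2_outside[OF bounded_ops_in_l2] .

lemma bounded_ops_add:
  "T \<in> bounded_ops I \<Longrightarrow> f \<in> l2 I \<Longrightarrow> g \<in> l2 I \<Longrightarrow> T (\<lambda>i. f i + g i) = (\<lambda>i. T f i + T g i)"
  by (simp add: bounded_ops_def)

lemma bounded_ops_scale:
  "T \<in> bounded_ops I \<Longrightarrow> f \<in> l2 I \<Longrightarrow> T (\<lambda>i. c * f i) = (\<lambda>i. c * T f i)"
  by (simp add: bounded_ops_def)

lemma bounded_ops_extensional: "T \<in> bounded_ops I \<Longrightarrow> T \<in> extensional (l2 I)"
  by (simp add: bounded_ops_def PiE_def)

lemma bounded_ops_zero:
  assumes "T \<in> bounded_ops I"
  shows "T (\<lambda>_. 0) = (\<lambda>_. 0)"
  using bounded_ops_scale[OF assms l2_zero, of 0] by simp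

lemma bounded_ops_sum:
  assumes "T \<in> bounded_ops I" "finite F" "F \<subseteq> I"
  shows "(\<lambda>i. \<Sum>v\<in>F. f v * \<xi> v i) \<in> l2 I"
    and "T (\<lambda>i. \<Sum>v\<in>F. f v * \<xi> v i) = (\<lambda>i. \<Sum>v\<in>F. f v * T (\<xi> v) i)"
proof -
  have "(\<lambda>i. \<Sum>v\<in>F. f v * \<xi> v i) \<in> l2 I \<and>
      T (\<lambda>i. \<Sum>v\<in>F. f v * \<xi> v i) = (\<lambda>i. \<Sum>v\<in>F. f v * T (\<xi> v) i)"
    using assms(2,3)
  proof (induction F rule: finite_induct)
    case empty
    then show ?case using bounded_ops_zero[OF assms(1)] l2_zero by simp
  next
    case (insert v F)
    then have v: "\<xi> v \<in> l2 I" "(\<lambda>i. f v * \<xi> v i) \<in> l2 I"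
      using basis_vec_in_l2 l2_scale by (metis insert_subset)+
    show ?case
      using insert v bounded_ops_add[OF assms(1) v(2)] bounded_ops_scale[OF assms(1) v(1)] l2_add(1)[OF v(2)]
      by simp
  qed
  then show "(\<lambda>i. \<Sum>v\<in>F. f v * \<xi> v i) \<in> l2 I"
    and "T (\<lambda>i. \<Sum>v\<in>F. f v * \<xi> v i) = (\<lambda>i. \<Sum>v\<in>F. f v * T (\<xi> v) i)" by auto
qed

lemma finite_basis_expansion:
  assumes "finite F"
  shows "(\<Sum>v\<in>F. f v * \<xi> v i) = (if i \<in> F then f i else 0)"
proof -
  have "(\<Sum>v\<in>F. f v * \<xi> v i) = (\<Sum>v\<in>F. if v = i then f v else 0)"
    by (intro sum.cong) (auto simp: basis_vec_def)
  then show ?thesis using assms by simp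
qed

text \<open>The matrix determines the operator by continuity: the truncations of \<open>f\<close> to
  finite sets \<open>S\<close> tend to \<open>f\<close> in norm, and the partial sum over
  \<open>S\<close> is off by at most \<open>sqrt K\<close> times the norm of \<open>f\<close>
  outside \<open>S\<close>.\<close>

lemma bounded_ops_has_sum:
  assumes T: "T \<in> bounded_ops I" and f: "f \<in> l2 I"
  shows "((\<lambda>v. f v * T (\<xi> v) z) has_sum T f z) I"
proof (cases "z \<in> I")
  case False
  have "T (\<xi> v) z = 0" if "v \<in> I" for v
    using bounded_ops_outside[OF T basis_vec_in_l2[OF that] False] .
  with False bounded_ops_outside[OF T f] show ?thesis
    by (simp add: has_sum_0)
next
  case z: True
  obtain K where K: "0 \<le> K"
    "\<forall>f\<in>l2 I. \<forall>F. finite F \<longrightarrow> F \<subseteq> I \<longrightarrow> (\<Sum>i\<in>F. (cmod (T f i))\<^sup>2) \<le> K * (l2_norm I f)\<^sup>2"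
    using bounded_ops_bound[OF T] by blast
  let ?q = "\<lambda>S. (\<Sum>i\<in>S. (cmod (f i))\<^sup>2)" and ?t = "\<lambda>S. (\<Sum>v\<in>S. f v * T (\<xi> v) z)"
  have bound: "(cmod (?t S - T f z))\<^sup>2 \<le> K * ((l2_norm I f)\<^sup>2 - ?q S)" if S: "finite S" "S \<subseteq> I" for S
  proof -
    define h where "h = (\<lambda>i. \<Sum>v\<in>S. f v * \<xi> v i)"
    have h: "h \<in> l2 I" "T h z = ?t S"
      using bounded_ops_sum[OF T S, of f] by (simp_all add: h_def)
    have h_eq: "h i = (if i \<in> S then f i else 0)" for i
      using finite_basis_expansion[OF S(1)] by (simp add: h_def)
    define g where "g = (\<lambda>i. h i + (-1) * f i)"
    have g: "g \<in> l2 I" "T g z = T h z - T f z"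
      using h(1) f l2_scale[OF f, of "-1"] bounded_ops_add[OF T h(1), of "\<lambda>i. (-1) * f i"]
        bounded_ops_scale[OF T f, of "-1"] l2_add(1)[OF h(1), of "\<lambda>i. (-1) * f i"]
      by (simp_all add: g_def)
    have "(l2_norm I g)\<^sup>2 \<le> (l2_norm I f)\<^sup>2 - ?q S"
    proof (rule l2_boundI(2))
      fix F assume F: "finite F" "F \<subseteq> I"
      have "(\<Sum>i\<in>F. (cmod (g i))\<^sup>2) = (\<Sum>i\<in>F - S. (cmod (f i))\<^sup>2)"
        by (rule sum.mono_neutral_cong_right) (use F in \<open>auto simp: g_def h_eq\<close>)
      also have "\<dots> + ?q S = (\<Sum>i\<in>(F - S) \<union> S. (cmod (f i))\<^sup>2)"
        by (rule sum.union_disjoint[symmetric]) (use F S in auto)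
      also have "\<dots> \<le> (l2_norm I f)\<^sup>2"
        by (rule l2_finite_sum_le[OF f]) (use F S in auto)
      finally show "(\<Sum>i\<in>F. (cmod (g i))\<^sup>2) \<le> (l2_norm I f)\<^sup>2 - ?q S" by simp
    qed (rule l2_outside[OF g(1)])
    then have "K * (l2_norm I g)\<^sup>2 \<le> K * ((l2_norm I f)\<^sup>2 - ?q S)"
      using K(1) by (rule mult_left_mono)
    moreover have "(cmod (T g z))\<^sup>2 \<le> K * (l2_norm I g)\<^sup>2"
      using K(2)[rule_format, OF g(1), of "{z}"] z by simp
    ultimately show ?thesis using g(2) h(2) by simp
  qed
  have "((\<lambda>S. sqrt (K * ((l2_norm I f)\<^sup>2 - ?q S))) \<longlongrightarrow> sqrt (K * ((l2_norm I f)\<^sup>2 - (l2_norm I f)\<^sup>2)))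
      (finite_subsets_at_top I)"
    using l2_norm_has_sum[OF f] unfolding has_sum_def by (intro tendsto_intros)
  then have lim: "((\<lambda>S. sqrt (K * ((l2_norm I f)\<^sup>2 - ?q S))) \<longlongrightarrow> 0) (finite_subsets_at_top I)"
    by simp
  have "((\<lambda>S. ?t S - T f z) \<longlongrightarrow> 0) (finite_subsets_at_top I)"
  proof (rule Lim_null_comparison[OF _ lim])
    show "\<forall>\<^sub>F S in finite_subsets_at_top I. cmod (?t S - T f z) \<le> sqrt (K * ((l2_norm I f)\<^sup>2 - ?q S))"
      by (rule eventually_finite_subsets_at_top_weakI) (rule real_le_rsqrt[OF bound])
  qed
  then show ?thesis
    unfolding has_sum_def by (rule Lim_null[THEN iffD2])
qed

text \<open>Serves matrix products in which only finitely many intermediate indices contribute; with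
  \<open>F = {}\<close> it shows that an entry vanishes.\<close>

lemma bounded_ops_finite_expansion:
  assumes "T \<in> bounded_ops I" "f \<in> l2 I" "finite F" "F \<subseteq> I"
    and "\<And>v. v \<in> I - F \<Longrightarrow> f v * T (\<xi> v) z = 0"
  shows "T f z = (\<Sum>v\<in>F. f v * T (\<xi> v) z)"
proof -
  have "((\<lambda>v. f v * T (\<xi> v) z) has_sum (\<Sum>v\<in>F. f v * T (\<xi> v) z)) I"
    by (rule has_sum_finite_neutralI[OF assms(3,4)]) (use assms(5) in auto)
  then show ?thesis
    by (rule has_sum_unique[OF bounded_ops_has_sum[OF assms(1,2)]])
qed

lemma bounded_ops_eqI:
  assumes S: "S \<in> bounded_ops I" and T: "T \<in> bounded_ops I"
    and eq: "\<And>v z. v \<in> I \<Longrightarrow> z \<in> I \<Longrightarrow> S (\<xi> v) z = T (\<xi> v) z"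
  shows "S = T"
proof (rule extensionalityI[of _ "l2 I"])
  fix f assume f: "f \<in> l2 I"
  show "S f = T f"
  proof
    fix z
    show "S f z = T f z"
    proof (cases "z \<in> I")
      case True
      have "((\<lambda>v. f v * S (\<xi> v) z) has_sum T f z) I"
        using bounded_ops_has_sum[OF T f, of z] eq True by (simp cong: has_sum_cong)
      then show ?thesis
        by (rule has_sum_unique[OF bounded_ops_has_sum[OF S f]])
    qed (simp add: bounded_ops_outside[OF S f] bounded_ops_outside[OF T f])
  qed
qed (use S T bounded_ops_extensional in auto)

lemma l2_inner_basis_vec:
  assumes "z \<in> I"
  shows "l2_inner I f (\<xi> z) = f z"
proof -
  have "((\<lambda>i. f i * cnj (\<xi> z i)) has_sum f z) I"
    by (rule has_sum_finite_neutralI[of "{z}"]) (use assms in \<open>auto simp: basis_vec_def\<close>)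
  then show ?thesis by (simp add: l2_inner_def infsumI)
qed

text \<open>The functional \<open>f \<mapsto> T f z\<close> is the inner product with the adjoint applied to \<open>\<xi> z\<close>.\<close>

lemma bounded_ops_row:
  assumes T: "T \<in> bounded_ops I" and z: "z \<in> I"
  shows "\<exists>g\<in>l2 I. \<forall>f\<in>l2 I. T f z = l2_inner I f g"
proof -
  define g where "g = (\<lambda>v. if v \<in> I then cnj (T (\<xi> v) z) else 0)"
  obtain K where K: "0 \<le> K"
    "\<forall>f\<in>l2 I. \<forall>F. finite F \<longrightarrow> F \<subseteq> I \<longrightarrow> (\<Sum>i\<in>F. (cmod (T f i))\<^sup>2) \<le> K * (l2_norm I f)\<^sup>2"
    using bounded_ops_bound[OF T] by blast
  have "(\<Sum>v\<in>F. (cmod (g v))\<^sup>2) \<le> K" if F: "finite F" "F \<subseteq> I" for F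
  proof -
    define q where "q = (\<Sum>v\<in>F. (cmod (g v))\<^sup>2)"
    \<comment> \<open>Testing \<open>T\<close> on \<open>g\<close> cut off to \<open>F\<close> turns
      the sum to be bounded into a value: \<open>T h z\<close> equals \<open>q\<close>, while
      \<open>h\<close> has squared norm at most \<open>q\<close>. Boundedness gives
      \<open>q\<^sup>2 \<le> K * q\<close>, hence \<open>q \<le> K\<close>.\<close>
    define h where "h = (\<lambda>i. \<Sum>v\<in>F. g v * \<xi> v i)"
    have q0: "0 \<le> q" unfolding q_def by (intro sum_nonneg) auto
    have h: "h \<in> l2 I" "T h z = (\<Sum>v\<in>F. g v * T (\<xi> v) z)"
      using bounded_ops_sum[OF T F, of g] by (simp_all add: h_def)
    have "(\<Sum>v\<in>F. g v * T (\<xi> v) z) = (\<Sum>v\<in>F. complex_of_real ((cmod (g v))\<^sup>2))"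
      by (intro sum.cong refl) (use F in \<open>auto simp: g_def complex_norm_square mult.commute simp del: of_real_power\<close>)
    then have "T h z = complex_of_real q"
      using h(2) by (simp add: q_def)
    moreover have "(l2_norm I h)\<^sup>2 \<le> q"
    proof (rule l2_boundI(2))
      fix E assume E: "finite E" "E \<subseteq> I"
      have "(\<Sum>i\<in>E. (cmod (h i))\<^sup>2) = (\<Sum>i\<in>E \<inter> F. (cmod (g i))\<^sup>2)"
        unfolding h_def finite_basis_expansion[OF F(1)]
        by (rule sum.mono_neutral_cong_right) (use E in auto)
      also have "\<dots> \<le> q"
        unfolding q_def by (rule sum_mono2) (use F in auto)
      finally show "(\<Sum>i\<in>E. (cmod (h i))\<^sup>2) \<le> q" .
    qed (rule l2_outside[OF h(1)])
    moreover have "(cmod (T h z))\<^sup>2 \<le> K * (l2_norm I h)\<^sup>2"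
      using K(2)[rule_format, OF h(1), of "{z}"] z by simp
    ultimately have "q\<^sup>2 \<le> K * q"
      using mult_left_mono[of "(l2_norm I h)\<^sup>2" q K] K(1) q0 by simp
    then show ?thesis
      using q0 K(1) unfolding q_def[symmetric] by (cases "q = 0") (simp_all add: power2_eq_square)
  qed
  then have "g \<in> l2 I"
    by (intro l2_boundI(1)[of I g K]) (auto simp: g_def)
  moreover have "T f z = l2_inner I f g" if "f \<in> l2 I" for f
  proof -
    have "l2_inner I f g = (\<Sum>\<^sub>\<infinity>v\<in>I. f v * T (\<xi> v) z)"
      unfolding l2_inner_def by (rule infsum_cong) (simp add: g_def)
    then show ?thesis
      using infsumI[OF bounded_ops_has_sum[OF T that]] by simp
  qed
  ultimately show ?thesis by blast
qed


section \<open>Operator algebras and the weak operator topology\<close>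

lemma op_id_bounded: "op_id I \<in> bounded_ops I"
  by (rule bounded_opsI[where K = 1])
     (auto simp: op_id_def l2_add l2_scale l2_outside l2_finite_sum_le)

lemma op_add_bounded:
  assumes S: "S \<in> bounded_ops I" and T: "T \<in> bounded_ops I"
  shows "op_add I S T \<in> bounded_ops I"
proof -
  obtain K where K: "0 \<le> K"
    "\<forall>f\<in>l2 I. \<forall>F. finite F \<longrightarrow> F \<subseteq> I \<longrightarrow> (\<Sum>i\<in>F. (cmod (S f i))\<^sup>2) \<le> K * (l2_norm I f)\<^sup>2"
    using bounded_ops_bound[OF S] by blast
  obtain M where M: "0 \<le> M"
    "\<forall>f\<in>l2 I. \<forall>F. finite F \<longrightarrow> F \<subseteq> I \<longrightarrow> (\<Sum>i\<in>F. (cmod (T f i))\<^sup>2) \<le> M * (l2_norm I f)\<^sup>2"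
    using bounded_ops_bound[OF T] by blast
  show ?thesis
  proof (rule bounded_opsI[where K = "2 * K + 2 * M"])
    fix f F assume f: "f \<in> l2 I" and F: "finite F" "F \<subseteq> I"
    have "(\<Sum>i\<in>F. (cmod (S f i + T f i))\<^sup>2) \<le> (\<Sum>i\<in>F. 2 * (cmod (S f i))\<^sup>2 + 2 * (cmod (T f i))\<^sup>2)"
      by (intro sum_mono cmod_add_square_le)
    also have "\<dots> = 2 * (\<Sum>i\<in>F. (cmod (S f i))\<^sup>2) + 2 * (\<Sum>i\<in>F. (cmod (T f i))\<^sup>2)"
      by (simp add: sum.distrib sum_distrib_left)
    also have "\<dots> \<le> (2 * K + 2 * M) * (l2_norm I f)\<^sup>2"
      using K(2)[rule_format, OF f F] M(2)[rule_format, OF f F] by (simp add: distrib_right)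
    finally show "(\<Sum>i\<in>F. (cmod (op_add I S T f i))\<^sup>2) \<le> (2 * K + 2 * M) * (l2_norm I f)\<^sup>2"
      using f by (simp add: op_add_def)
  qed (auto simp: op_add_def l2_add l2_scale bounded_ops_add[OF S] bounded_ops_add[OF T]
        bounded_ops_scale[OF S] bounded_ops_scale[OF T] bounded_ops_outside[OF S]
        bounded_ops_outside[OF T] algebra_simps)
qed

lemma op_scale_bounded:
  assumes T: "T \<in> bounded_ops I"
  shows "op_scale I c T \<in> bounded_ops I"
proof -
  obtain M where M: "0 \<le> M"
    "\<forall>f\<in>l2 I. \<forall>F. finite F \<longrightarrow> F \<subseteq> I \<longrightarrow> (\<Sum>i\<in>F. (cmod (T f i))\<^sup>2) \<le> M * (l2_norm I f)\<^sup>2"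
    using bounded_ops_bound[OF T] by blast
  show ?thesis
  proof (rule bounded_opsI[where K = "(cmod c)\<^sup>2 * M"])
    fix f F assume f: "f \<in> l2 I" and F: "finite F" "F \<subseteq> I"
    have "(\<Sum>i\<in>F. (cmod (op_scale I c T f i))\<^sup>2) = (cmod c)\<^sup>2 * (\<Sum>i\<in>F. (cmod (T f i))\<^sup>2)"
      using f by (simp add: op_scale_def norm_mult power_mult_distrib sum_distrib_left)
    then show "(\<Sum>i\<in>F. (cmod (op_scale I c T f i))\<^sup>2) \<le> (cmod c)\<^sup>2 * M * (l2_norm I f)\<^sup>2"
      using M(2)[rule_format, OF f F] by (simp add: mult.assoc mult_left_mono)
  qed (auto simp: op_scale_def l2_add l2_scale bounded_ops_add[OF T]
        bounded_ops_scale[OF T] bounded_ops_outside[OF T] algebra_simps)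
qed

lemma op_mult_apply: "f \<in> l2 I \<Longrightarrow> op_mult I S T f = S (T f)"
  by (simp add: op_mult_def compose_def)

lemma op_mult_eq_iff:
  "op_mult I A B = op_mult I C D \<longleftrightarrow> (\<forall>f\<in>l2 I. A (B f) = C (D f))"
proof
  assume eq: "op_mult I A B = op_mult I C D"
  show "\<forall>f\<in>l2 I. A (B f) = C (D f)"
  proof
    fix f assume "f \<in> l2 I"
    then show "A (B f) = C (D f)"
      using fun_cong[OF eq, of f] by (simp add: op_mult_apply)
  qed
next
  assume "\<forall>f\<in>l2 I. A (B f) = C (D f)"
  then show "op_mult I A B = op_mult I C D"
    unfolding op_mult_def compose_def by (intro restrict_ext) auto
qed

lemma op_mult_bounded:
  assumes S: "S \<in> bounded_ops I" and T: "T \<in> bounded_ops I"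
  shows "op_mult I S T \<in> bounded_ops I"
proof -
  obtain K where K: "0 \<le> K"
    "\<forall>f\<in>l2 I. \<forall>F. finite F \<longrightarrow> F \<subseteq> I \<longrightarrow> (\<Sum>i\<in>F. (cmod (S f i))\<^sup>2) \<le> K * (l2_norm I f)\<^sup>2"
    using bounded_ops_bound[OF S] by blast
  obtain M where M: "0 \<le> M"
    "\<forall>f\<in>l2 I. \<forall>F. finite F \<longrightarrow> F \<subseteq> I \<longrightarrow> (\<Sum>i\<in>F. (cmod (T f i))\<^sup>2) \<le> M * (l2_norm I f)\<^sup>2"
    using bounded_ops_bound[OF T] by blast
  note inT = bounded_ops_in_l2[OF T]
  show ?thesis
  proof (rule bounded_opsI[where K = "K * M"])
    fix f F assume f: "f \<in> l2 I" and F: "finite F" "F \<subseteq> I"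
    have "(l2_norm I (T f))\<^sup>2 \<le> M * (l2_norm I f)\<^sup>2"
      by (rule l2_boundI(2)[OF bounded_ops_outside[OF T f] M(2)[rule_format, OF f]])
    then have "K * (l2_norm I (T f))\<^sup>2 \<le> K * (M * (l2_norm I f)\<^sup>2)"
      using K(1) by (rule mult_left_mono)
    then show "(\<Sum>i\<in>F. (cmod (op_mult I S T f i))\<^sup>2) \<le> K * M * (l2_norm I f)\<^sup>2"
      using K(2)[rule_format, OF inT[OF f] F] f by (simp add: op_mult_apply mult.assoc)
  qed (auto simp: op_mult_apply l2_add l2_scale bounded_ops_add[OF T] bounded_ops_add[OF S]
        bounded_ops_scale[OF S] bounded_ops_scale[OF T] bounded_ops_outside[OF S] inT,
       simp add: op_mult_def)
qed

lemma bounded_ops_algebra: "unital_operator_algebra I (bounded_ops I)"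
  by (simp add: unital_operator_algebra_def op_id_bounded op_add_bounded op_scale_bounded op_mult_bounded)

lemma commutant_algebra:
  assumes "\<S> \<subseteq> bounded_ops I"
  shows "unital_operator_algebra I (commutant I \<S>)"
proof -
  have comm: "A \<in> commutant I \<S> \<longleftrightarrow>
      A \<in> bounded_ops I \<and> (\<forall>S\<in>\<S>. \<forall>f\<in>l2 I. A (S f) = S (A f))" for A
  proof -
    show ?thesis by (simp add: commutant_def op_mult_eq_iff)
  qed
  have S: "S \<in> bounded_ops I" if "S \<in> \<S>" for S using assms that by blast
  have S_l2: "S f \<in> l2 I" if "S \<in> \<S>" "f \<in> l2 I" for S f
    using bounded_ops_in_l2[OF S] that by simp
  show ?thesis
    unfolding unital_operator_algebra_def
  proof (intro conjI ballI allI subsetI)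
    show "op_id I \<in> commutant I \<S>"
      by (simp add: comm op_id_bounded) (simp add: op_id_def S_l2)
  next
    fix A B assume "A \<in> commutant I \<S>" "B \<in> commutant I \<S>"
    then have A: "A \<in> bounded_ops I" "\<forall>S\<in>\<S>. \<forall>f\<in>l2 I. A (S f) = S (A f)"
      and B: "B \<in> bounded_ops I" "\<forall>S\<in>\<S>. \<forall>f\<in>l2 I. B (S f) = S (B f)"
      by (simp_all add: comm)
    note in_l2 = bounded_ops_in_l2[OF A(1)] bounded_ops_in_l2[OF B(1)]
    show "op_add I A B \<in> commutant I \<S>"
      using A B in_l2 bounded_ops_add[OF S]
      by (simp add: comm op_add_bounded) (simp add: op_add_def S_l2)
    show "op_mult I A B \<in> commutant I \<S>"
      using A B in_l2 by (simp add: comm op_mult_bounded op_mult_apply S_l2)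
  next
    fix A c assume "A \<in> commutant I \<S>"
    then have A: "A \<in> bounded_ops I" "\<forall>S\<in>\<S>. \<forall>f\<in>l2 I. A (S f) = S (A f)"
      by (simp_all add: comm)
    show "op_scale I c A \<in> commutant I \<S>"
      using A bounded_ops_in_l2[OF A(1)] bounded_ops_scale[OF S]
      by (simp add: comm op_scale_bounded) (simp add: op_scale_def S_l2)
  qed (simp add: comm)
qed

section \<open>Weakly continuous functionals and weakly closed sets of operators\<close>

lemma continuous_map_weak_operator:
  assumes "f \<in> l2 I" "g \<in> l2 I"
  shows "continuous_map (weak_operator_topology_on I) euclidean (\<lambda>T. l2_inner I (T f) g)"
proof -
  have "continuous_map (weak_operator_topology_on I) euclidean
      ((\<lambda>x. x (f, g)) \<circ> (\<lambda>T. \<lambda>(f, g)\<in>l2 I \<times> l2 I. l2_inner I (T f) g))"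
    unfolding weak_operator_topology_on_def
    by (rule continuous_map_pullback)
       (use continuous_map_product_projection[of "(f, g)" "l2 I \<times> l2 I" "\<lambda>_. euclidean"] assms in simp)
  then show ?thesis
    using assms by (simp add: o_def)
qed

lemma continuous_map_weak_operator_entry:
  assumes "f \<in> l2 I" "z \<in> I"
  shows "continuous_map (weak_operator_topology_on I) euclidean (\<lambda>T. T f z)"
  using continuous_map_weak_operator[OF assms(1) basis_vec_in_l2[OF assms(2)]]
  by (simp add: l2_inner_basis_vec[OF assms(2)])

lemma closedin_weak_operator_eq:
  fixes \<phi> \<psi> :: "'i op \<Rightarrow> complex"
  assumes "continuous_map (weak_operator_topology_on I) euclidean \<phi>"
    and "continuous_map (weak_operator_topology_on I) euclidean \<psi>"
  shows "closedin (weak_operator_topology_on I) {T \<in> bounded_ops I. \<phi> T = \<psi> T}"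
proof -
  have "continuous_map (weak_operator_topology_on I) euclidean (\<lambda>T. \<phi> T - \<psi> T)"
    using assms by (intro continuous_intros)
  then have "closedin (weak_operator_topology_on I)
      {T \<in> topspace (weak_operator_topology_on I). \<phi> T - \<psi> T \<in> {0}}"
    by (rule closedin_continuous_map_preimage) simp
  then show ?thesis by simp
qed

lemma closedin_weak_operator_Inter:
  assumes "\<And>i. i \<in> J \<Longrightarrow> closedin (weak_operator_topology_on I) {T \<in> bounded_ops I. P i T}"
  shows "closedin (weak_operator_topology_on I) {T \<in> bounded_ops I. \<forall>i\<in>J. P i T}"
proof -
  \<comment> \<open>The factor \<open>bounded_ops I\<close> matters for empty \<open>J\<close>,
    where the bare intersection is \<open>UNIV\<close>.\<close>
  have "{T \<in> bounded_ops I. \<forall>i\<in>J. P i T} =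
      bounded_ops I \<inter> \<Inter>((\<lambda>i. {T \<in> bounded_ops I. P i T}) ` J)" by auto
  moreover have "closedin (weak_operator_topology_on I) (bounded_ops I)"
    using closedin_topspace[of "weak_operator_topology_on I"] by simp
  ultimately show ?thesis
    using assms by (cases "J = {}") (auto intro!: closedin_Int closedin_Inter)
qed

text \<open>For fixed \<open>S\<close>, \<open>f\<close>, \<open>z\<close> both sides of
  \<open>T (S f) z = S (T f) z\<close> are weakly continuous in \<open>T\<close>: the left one is a
  coordinate of \<open>T\<close> at a fixed vector, and on the right \<open>bounded_ops_row\<close>
  rewrites evaluation of \<open>S\<close> at \<open>z\<close> as the inner product with a fixed
  vector.\<close>

lemma closedin_commutant:
  assumes "\<S> \<subseteq> bounded_ops I"
  shows "closedin (weak_operator_topology_on I) (commutant I \<S>)"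
proof -
  have "closedin (weak_operator_topology_on I) {T \<in> bounded_ops I. T (S f) z = S (T f) z}"
    if S: "S \<in> bounded_ops I" and f: "f \<in> l2 I" and z: "z \<in> I" for S f z
  proof -
    obtain g where g: "g \<in> l2 I" "\<forall>f\<in>l2 I. S f z = l2_inner I f g"
      using bounded_ops_row[OF S z] by blast
    have "{T \<in> bounded_ops I. T (S f) z = S (T f) z} =
        {T \<in> bounded_ops I. T (S f) z = l2_inner I (T f) g}"
      using g(2) bounded_ops_in_l2[OF _ f] by auto
    then show ?thesis
      using closedin_weak_operator_eq[OF continuous_map_weak_operator_entry[OF bounded_ops_in_l2[OF S f] z]
          continuous_map_weak_operator[OF f g(1)]] by simp
  qed
  then have "closedin (weak_operator_topology_on I)
      {T \<in> bounded_ops I. \<forall>S\<in>\<S>. \<forall>f\<in>l2 I. \<forall>z\<in>I. T (S f) z = S (T f) z}"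
    using assms by (intro closedin_weak_operator_Inter) auto
  moreover have "commutant I \<S> = {T \<in> bounded_ops I. \<forall>S\<in>\<S>. \<forall>f\<in>l2 I. \<forall>z\<in>I. T (S f) z = S (T f) z}"
  proof -
    have "op_mult I T S = op_mult I S T \<longleftrightarrow> (\<forall>f\<in>l2 I. \<forall>z\<in>I. T (S f) z = S (T f) z)"
      if T: "T \<in> bounded_ops I" and S: "S \<in> bounded_ops I" for S T
    proof -
      have "T (S f) = S (T f) \<longleftrightarrow> (\<forall>z\<in>I. T (S f) z = S (T f) z)" if "f \<in> l2 I" for f
        using bounded_ops_outside[OF T bounded_ops_in_l2[OF S that]]
          bounded_ops_outside[OF S bounded_ops_in_l2[OF T that]] unfolding fun_eq_iff by metis
      then show ?thesis by (simp add: op_mult_eq_iff)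
    qed
    then show ?thesis
      using assms unfolding commutant_def by (intro Collect_cong conj_cong ball_cong refl) auto
  qed
  ultimately show ?thesis by simp
qed

lemma closedin_weak_operator_sequentially:
  assumes "closedin (weak_operator_topology_on I) \<A>" "\<And>n. B n \<in> \<A>" "A \<in> bounded_ops I"
    and "\<And>f g. f \<in> l2 I \<Longrightarrow> g \<in> l2 I \<Longrightarrow> (\<lambda>n. l2_inner I (B n f) g) \<longlonglongrightarrow> l2_inner I (A f) g"
  shows "A \<in> \<A>"
proof -
  define \<Phi> where "\<Phi> = (\<lambda>T. \<lambda>(f, g)\<in>l2 I \<times> l2 I. l2_inner I (T f) g)"
  have Bb: "B n \<in> bounded_ops I" for n
    using assms(1,2) closedin_subset by fastforce
  have lim: "limitin (product_topology (\<lambda>_. euclidean) (l2 I \<times> l2 I)) (\<lambda>n. \<Phi> (B n)) (\<Phi> A) sequentially"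
    unfolding limitin_componentwise using assms(4) by (auto simp: \<Phi>_def)
  have "limitin (weak_operator_topology_on I) B A sequentially"
    unfolding limitin_def
  proof (intro conjI allI impI)
    fix U assume "openin (weak_operator_topology_on I) U \<and> A \<in> U"
    then obtain V where V: "openin (product_topology (\<lambda>_. euclidean) (l2 I \<times> l2 I)) V"
      "U = \<Phi> -` V \<inter> bounded_ops I" "A \<in> U"
      unfolding weak_operator_topology_on_def openin_pullback_topology \<Phi>_def by blast
    then have "\<forall>\<^sub>F n in sequentially. \<Phi> (B n) \<in> V"
      using lim unfolding limitin_def by blast
    then show "\<forall>\<^sub>F n in sequentially. B n \<in> U"
      by eventually_elim (use V Bb in blast)
  qed (use assms(3) in simp)
  then show ?thesis
    by (rule limitin_closedin[OF _ assms(1)]) (use assms(2) in auto)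
qed

lemma wot_closed_algebra_generated_minimal:
  assumes "\<S> \<subseteq> \<A>" "unital_operator_algebra I \<A>" "closedin (weak_operator_topology_on I) \<A>"
  shows "wot_closed_algebra_generated I \<S> \<subseteq> \<A>"
  unfolding wot_closed_algebra_generated_def using assms by (intro hull_minimal) auto

section \<open>Fejer means of triangular operators\<close>

lemma l2_inner_has_sum:
  assumes "f \<in> l2 I" "g \<in> l2 I"
  shows "((\<lambda>i. f i * cnj (g i)) has_sum l2_inner I f g) I"
proof -
  have "(\<lambda>i. (cmod (f i))\<^sup>2 + (cmod (g i))\<^sup>2) summable_on I"
    using assms by (intro summable_on_add) (auto simp: l2_def)
  moreover have "cmod (f i * cnj (g i)) \<le> (cmod (f i))\<^sup>2 + (cmod (g i))\<^sup>2" for i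
  proof -
    have "2 * (cmod (f i) * cmod (g i)) \<le> (cmod (f i))\<^sup>2 + (cmod (g i))\<^sup>2"
      using sum_squares_bound[of "cmod (f i)" "cmod (g i)"] by (simp add: mult.assoc)
    moreover have "0 \<le> cmod (f i) * cmod (g i)" by simp
    ultimately show ?thesis
      unfolding norm_mult complex_mod_cnj by linarith
  qed
  ultimately have "(\<lambda>i. norm (f i * cnj (g i))) summable_on I"
    by (rule summable_on_comparison_test) auto
  then show ?thesis
    unfolding l2_inner_def by (rule has_sum_infsum[OF abs_summable_summable])
qed

text \<open>A finite set \<open>S\<close> carries \<open>g\<close> up to a small tail. On
  \<open>S\<close> the entrywise limit applies; off \<open>S\<close> the uniform bound
  \<open>M\<close> meets the small tail of \<open>g\<close>.\<close>

lemma l2_inner_tendsto_zero: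
  assumes D: "\<And>n. D n \<in> l2 I" "\<And>n. (l2_norm I (D n))\<^sup>2 \<le> M"
    and lim: "\<And>z. z \<in> I \<Longrightarrow> (\<lambda>n. D n z) \<longlonglongrightarrow> 0"
    and g: "g \<in> l2 I"
  shows "(\<lambda>n. l2_inner I (D n) g) \<longlonglongrightarrow> 0"
proof (rule LIMSEQ_I)
  fix \<epsilon> :: real assume \<epsilon>: "0 < \<epsilon>"
  have M: "0 \<le> M"
    using D(2)[of 0] zero_le_power2[of "l2_norm I (D 0)"] by linarith
  \<comment> \<open>The budget is at most \<open>\<delta> * M + \<delta>\<close> off
    \<open>S\<close> and less than \<open>\<delta>\<close> on \<open>S\<close> for large
    \<open>n\<close>, in total less than \<open>\<delta> * (M + 3)\<close>.\<close>
  define \<delta> where "\<delta> = \<epsilon> / (M + 3)"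
  have \<delta>: "0 < \<delta>" "\<delta> * (M + 3) = \<epsilon>"
    using \<epsilon> M by (simp_all add: \<delta>_def)
  have "\<forall>\<^sub>F S in finite_subsets_at_top I. dist (\<Sum>i\<in>S. (cmod (g i))\<^sup>2) ((l2_norm I g)\<^sup>2) < \<delta>\<^sup>2"
    using l2_norm_has_sum[OF g] \<delta>(1) unfolding has_sum_def tendsto_iff by simp
  then obtain S where S: "finite S" "S \<subseteq> I" "dist (\<Sum>i\<in>S. (cmod (g i))\<^sup>2) ((l2_norm I g)\<^sup>2) < \<delta>\<^sup>2"
    unfolding eventually_finite_subsets_at_top by blast
  then have tail: "(l2_norm I g)\<^sup>2 - (\<Sum>i\<in>S. (cmod (g i))\<^sup>2) < \<delta>\<^sup>2"
    by (simp add: dist_real_def)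
  have bound: "cmod (l2_inner I (D n) g) \<le> (\<Sum>i\<in>S. cmod (D n i) * cmod (g i)) + \<delta> * (M + 1)" for n
  proof -
    have "cmod (\<Sum>i\<in>F. D n i * cnj (g i)) \<le> (\<Sum>i\<in>S. cmod (D n i) * cmod (g i)) + \<delta> * (M + 1)"
      if F: "finite F" "S \<subseteq> F" "F \<subseteq> I" for F
    proof -
      have split: "(\<Sum>i\<in>F. h i) = (\<Sum>i\<in>S. h i) + (\<Sum>i\<in>F - S. h i)" for h :: "'a \<Rightarrow> real"
        using sum.subset_diff[OF F(2,1), of h] by simp
      have "cmod (\<Sum>i\<in>F. D n i * cnj (g i)) \<le> (\<Sum>i\<in>F. cmod (D n i) * cmod (g i))"
        using norm_sum[of "\<lambda>i. D n i * cnj (g i)" F] by (simp add: norm_mult)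
      moreover have "(\<Sum>i\<in>F - S. cmod (D n i) * cmod (g i)) \<le>
          (\<Sum>i\<in>F - S. \<delta> * (cmod (D n i))\<^sup>2 + (cmod (g i))\<^sup>2 / \<delta>)"
      proof (rule sum_mono)
        fix i
        \<comment> \<open>The two factors are weighted unequally: the entries of \<open>D n\<close>
          are only known to be bounded and get the small weight \<open>\<delta>\<close>, whereas the
          tail of \<open>g\<close> is below \<open>\<delta>\<^sup>2\<close> and can afford division
          by \<open>\<delta>\<close>.\<close>
        define a b where "a = sqrt \<delta> * cmod (D n i)" and "b = cmod (g i) / sqrt \<delta>"
        have ab0: "0 \<le> a * b"
          using \<delta>(1) by (simp add: a_def b_def)
        have "cmod (D n i) * cmod (g i) = a * b"
          using \<delta>(1) by (simp add: a_def b_def)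
        also have "\<dots> \<le> a\<^sup>2 + b\<^sup>2"
          using sum_squares_bound[of a b] ab0 by linarith
        also have "\<dots> = \<delta> * (cmod (D n i))\<^sup>2 + (cmod (g i))\<^sup>2 / \<delta>"
          using \<delta>(1) by (simp add: a_def b_def power_mult_distrib power_divide)
        finally show "cmod (D n i) * cmod (g i) \<le> \<delta> * (cmod (D n i))\<^sup>2 + (cmod (g i))\<^sup>2 / \<delta>" .
      qed
      moreover have "(\<Sum>i\<in>F - S. \<delta> * (cmod (D n i))\<^sup>2 + (cmod (g i))\<^sup>2 / \<delta>) =
          \<delta> * (\<Sum>i\<in>F - S. (cmod (D n i))\<^sup>2) + (\<Sum>i\<in>F - S. (cmod (g i))\<^sup>2) / \<delta>"
        by (simp add: sum.distrib sum_distrib_left sum_divide_distrib)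
      moreover have "(\<Sum>i\<in>F - S. (cmod (D n i))\<^sup>2) \<le> M"
        using l2_finite_sum_le[OF D(1), of "F - S" n] D(2)[of n] F by force
      then have "\<delta> * (\<Sum>i\<in>F - S. (cmod (D n i))\<^sup>2) \<le> \<delta> * M"
        using \<delta>(1) by (simp add: mult_left_mono)
      moreover have "(\<Sum>i\<in>F - S. (cmod (g i))\<^sup>2) \<le> \<delta>\<^sup>2"
        using l2_finite_sum_le[OF g F(1,3)] split[of "\<lambda>i. (cmod (g i))\<^sup>2"] tail by linarith
      then have "(\<Sum>i\<in>F - S. (cmod (g i))\<^sup>2) / \<delta> \<le> \<delta>"
        using \<delta>(1) by (simp add: divide_le_eq power2_eq_square)
      ultimately show ?thesis
        using split[of "\<lambda>i. cmod (D n i) * cmod (g i)"] by (simp add: distrib_left)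
    qed
    then have ev: "\<forall>\<^sub>F F in finite_subsets_at_top I. cmod (\<Sum>i\<in>F. D n i * cnj (g i)) \<le>
        (\<Sum>i\<in>S. cmod (D n i) * cmod (g i)) + \<delta> * (M + 1)"
      using S(1,2) unfolding eventually_finite_subsets_at_top by auto
    have "((\<lambda>F. cmod (\<Sum>i\<in>F. D n i * cnj (g i))) \<longlongrightarrow> cmod (l2_inner I (D n) g)) (finite_subsets_at_top I)"
      using l2_inner_has_sum[OF D(1) g] unfolding has_sum_def by (rule tendsto_norm)
    then show ?thesis
      using ev by (rule tendsto_upperbound) simp
  qed
  have "(\<lambda>n. \<Sum>i\<in>S. cmod (D n i) * cmod (g i)) \<longlonglongrightarrow> (\<Sum>i\<in>S. cmod 0 * cmod (g i))"
    using S(2) lim by (intro tendsto_intros) auto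
  then have "(\<lambda>n. \<Sum>i\<in>S. cmod (D n i) * cmod (g i)) \<longlonglongrightarrow> 0" by simp
  from LIMSEQ_D[OF this \<delta>(1)] obtain n0
    where n0: "\<forall>n\<ge>n0. norm ((\<Sum>i\<in>S. cmod (D n i) * cmod (g i)) - 0) < \<delta>" ..
  have "norm (l2_inner I (D n) g - 0) < \<epsilon>" if "n \<ge> n0" for n
  proof -
    have "cmod (l2_inner I (D n) g) < \<delta> + \<delta> * (M + 1)"
      using bound[of n] n0[rule_format, OF that] by simp
    also have "\<dots> < \<delta> * (M + 3)"
      using \<delta>(1) by (simp add: distrib_left)
    finally show ?thesis using \<delta>(2) by simp
  qed
  then show "\<exists>n0. \<forall>n\<ge>n0. norm (l2_inner I (D n) g - 0) < \<epsilon>" by (intro exI allI impI)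
qed

lemma l2_inner_tendsto:
  assumes D: "\<And>n. D n \<in> l2 I" "\<And>n. (l2_norm I (D n))\<^sup>2 \<le> M"
    and lim: "\<And>z. z \<in> I \<Longrightarrow> (\<lambda>n. D n z) \<longlonglongrightarrow> h z"
    and h: "h \<in> l2 I" and g: "g \<in> l2 I"
  shows "(\<lambda>n. l2_inner I (D n) g) \<longlonglongrightarrow> l2_inner I h g"
proof -
  define E where "E = (\<lambda>n i. D n i + (-1) * h i)"
  note mh = l2_scale[OF h, of "-1"]
  have E: "E n \<in> l2 I" for n
    unfolding E_def by (rule l2_add(1)[OF D(1) mh])
  have EM: "(l2_norm I (E n))\<^sup>2 \<le> 2 * M + 2 * (l2_norm I h)\<^sup>2" for n
    using l2_add(2)[OF D(1)[of n] mh] D(2)[of n] l2_norm_scale[of I "-1" h] by (simp add: E_def)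
  have "(\<lambda>n. l2_inner I (E n) g) \<longlonglongrightarrow> 0"
  proof (rule l2_inner_tendsto_zero[OF E EM _ g])
    fix z assume z: "z \<in> I"
    show "(\<lambda>n. E n z) \<longlonglongrightarrow> 0"
      using tendsto_diff[OF lim[OF z] tendsto_const[of "h z"]] by (simp add: E_def)
  qed
  moreover have "l2_inner I (E n) g = l2_inner I (D n) g - l2_inner I h g" for n
  proof -
    have "((\<lambda>i. D n i * cnj (g i) + - (h i * cnj (g i))) has_sum l2_inner I (D n) g + - l2_inner I h g) I"
      using l2_inner_has_sum[OF D(1) g] l2_inner_has_sum[OF h g]
      by (intro has_sum_add) (simp_all add: has_sum_uminus)
    then have "((\<lambda>i. E n i * cnj (g i)) has_sum l2_inner I (D n) g - l2_inner I h g) I"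
      by (simp add: E_def algebra_simps)
    then show ?thesis
      by (simp add: l2_inner_def infsumI)
  qed
  ultimately show ?thesis
    by (simp add: LIM_zero_iff)
qed

text \<open>The matrix of \<open>A\<close> is multiplied entrywise by the Fejer kernel in the level
  difference. The range \<open>d v \<le> d z\<close> is where a triangular matrix lives, and with
  finite levels it keeps the sum finite; over an infinite index set \<open>sum\<close> would return
  the default 0.\<close>

definition fejer_mean :: "'i set \<Rightarrow> ('i \<Rightarrow> nat) \<Rightarrow> nat \<Rightarrow> 'i op \<Rightarrow> 'i op" where
  "fejer_mean I d N A = (\<lambda>f z. if z \<in> I then
     \<Sum>v | v \<in> I \<and> d v \<le> d z.
       of_real (max 0 (1 - (real (d z) - real (d v)) / real N)) * A (\<xi> v) z * f v else 0)"

locale triangular_operator =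
  fixes I :: "'i set" and d :: "'i \<Rightarrow> nat" and A :: "'i op"
  assumes bounded: "A \<in> bounded_ops I"
    and finite_level: "finite {v \<in> I. d v = n}"
    and triangular: "v \<in> I \<Longrightarrow> z \<in> I \<Longrightarrow> A (\<xi> v) z \<noteq> 0 \<Longrightarrow> d v \<le> d z"
begin

lemma finite_levels: "finite {v \<in> I. d v \<le> n}"
proof -
  have "{v \<in> I. d v \<le> n} = (\<Union>k\<in>{..n}. {v \<in> I. d v = k})" by auto
  then show ?thesis using finite_level by simp
qed

lemma apply_eq_sum:
  assumes "f \<in> l2 I" "z \<in> I"
  shows "A f z = (\<Sum>v | v \<in> I \<and> d v \<le> d z. f v * A (\<xi> v) z)"
  by (rule bounded_ops_finite_expansion[OF bounded assms(1) finite_levels])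
     (use triangular assms(2) in auto)

text \<open>The part of \<open>f\<close> on the \<open>N\<close> levels ending at \<open>s\<close>.
  The lower end is written \<open>s < d v + N\<close> because \<open>s - N\<close> would be
  truncated for small \<open>s\<close>.\<close>

definition window :: "nat \<Rightarrow> nat \<Rightarrow> ('i \<Rightarrow> complex) \<Rightarrow> 'i \<Rightarrow> complex" where
  "window N s f v = (if d v \<le> s \<and> s < d v + N then f v else 0)"

lemma window_l2:
  assumes "f \<in> l2 I"
  shows "window N s f \<in> l2 I"
proof (rule l2_boundI(1))
  fix F assume F: "finite F" "F \<subseteq> I"
  have "(\<Sum>i\<in>F. (cmod (window N s f i))\<^sup>2) \<le> (\<Sum>i\<in>F. (cmod (f i))\<^sup>2)"
    by (intro sum_mono) (simp add: window_def)
  also have "\<dots> \<le> (l2_norm I f)\<^sup>2"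
    by (rule l2_finite_sum_le[OF assms F])
  finally show "(\<Sum>i\<in>F. (cmod (window N s f i))\<^sup>2) \<le> (l2_norm I f)\<^sup>2" .
qed (use l2_outside[OF assms] in \<open>simp add: window_def\<close>)

text \<open>
  The Fejer kernel \<open>(1 - (i - j) / N)\<^sup>+\<close> is the average over the translates of a window of length
  \<open>N\<close> of the products of indicators, so Fejer means are averages of compressions.
\<close>

lemma fejer_mean_window:
  assumes f: "f \<in> l2 I" and z: "z \<in> I" and N: "0 < N"
  shows "of_nat N * fejer_mean I d N A f z = (\<Sum>s\<in>{d z..<d z + N}. A (window N s f) z)"
proof -
  let ?W = "{v \<in> I. d v \<le> d z}"
  have "(\<Sum>s\<in>{d z..<d z + N}. A (window N s f) z) =
      (\<Sum>s\<in>{d z..<d z + N}. \<Sum>v\<in>?W. window N s f v * A (\<xi> v) z)"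
    using apply_eq_sum[OF window_l2[OF f] z] by simp
  also have "\<dots> = (\<Sum>v\<in>?W. \<Sum>s\<in>{d z..<d z + N}. window N s f v * A (\<xi> v) z)"
    by (rule sum.swap)
  also have "\<dots> = (\<Sum>v\<in>?W. of_nat N * (of_real (max 0 (1 - (real (d z) - real (d v)) / real N))
      * A (\<xi> v) z * f v))"
  proof (rule sum.cong[OF refl])
    fix v assume v: "v \<in> ?W"
    have "(\<Sum>s\<in>{d z..<d z + N}. window N s f v * A (\<xi> v) z) =
        (\<Sum>s\<in>{d z..<d v + N}. f v * A (\<xi> v) z)"
      by (rule sum.mono_neutral_cong_right) (use v in \<open>auto simp: window_def\<close>)
    also have "\<dots> = of_nat (d v + N - d z) * (f v * A (\<xi> v) z)"
      by simp
    \<comment> \<open>The number of windows that contain both levels. Truncated subtraction of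
      naturals is exactly the positive part in the kernel.\<close>
    also have "of_nat (d v + N - d z) =
        (of_real (real N * max 0 (1 - (real (d z) - real (d v)) / real N)) :: complex)"
    proof -
      have "real (d v + N - d z) = real N * max 0 (1 - (real (d z) - real (d v)) / real N)"
        using v N by (auto simp: max_def field_simps of_nat_diff)
      then show ?thesis by (metis of_real_of_nat_eq)
    qed
    finally show "(\<Sum>s\<in>{d z..<d z + N}. window N s f v * A (\<xi> v) z) = of_nat N *
        (of_real (max 0 (1 - (real (d z) - real (d v)) / real N)) * A (\<xi> v) z * f v)"
      by (simp add: mult_ac)
  qed
  finally show ?thesis
    using z by (simp add: fejer_mean_def sum_distrib_left)
qed

text \<open>Each level lies in exactly \<open>N\<close> windows, those with \<open>s\<close> in
  \<open>{d v..<d v + N}\<close>. The cutoff \<open>m\<close> leaves finitely many indices, so that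
  the two sums can be swapped.\<close>

lemma sum_window_norm_le:
  assumes f: "f \<in> l2 I"
  shows "(\<Sum>s<m. (l2_norm I (window N s f))\<^sup>2) \<le> real N * (l2_norm I f)\<^sup>2"
proof -
  let ?V = "{v \<in> I. d v \<le> m}"
  have "(l2_norm I (window N s f))\<^sup>2 \<le> (\<Sum>v\<in>?V. (cmod (window N s f v))\<^sup>2)" if "s < m" for s
  proof (rule l2_boundI(2))
    fix F assume F: "finite F" "F \<subseteq> I"
    have "(\<Sum>i\<in>F. (cmod (window N s f i))\<^sup>2) = (\<Sum>i\<in>F \<inter> ?V. (cmod (window N s f i))\<^sup>2)"
      by (rule sum.mono_neutral_right) (use F that in \<open>auto simp: window_def\<close>)
    also have "\<dots> \<le> (\<Sum>v\<in>?V. (cmod (window N s f v))\<^sup>2)"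
      by (rule sum_mono2[OF finite_levels]) auto
    finally show "(\<Sum>i\<in>F. (cmod (window N s f i))\<^sup>2) \<le> (\<Sum>v\<in>?V. (cmod (window N s f v))\<^sup>2)" .
  qed (rule l2_outside[OF window_l2[OF f]])
  then have "(\<Sum>s<m. (l2_norm I (window N s f))\<^sup>2) \<le> (\<Sum>s<m. \<Sum>v\<in>?V. (cmod (window N s f v))\<^sup>2)"
    by (intro sum_mono) simp
  also have "\<dots> = (\<Sum>v\<in>?V. \<Sum>s<m. (cmod (window N s f v))\<^sup>2)"
    by (rule sum.swap)
  also have "\<dots> \<le> (\<Sum>v\<in>?V. real N * (cmod (f v))\<^sup>2)"
  proof (rule sum_mono)
    fix v
    have "(\<Sum>s<m. (cmod (window N s f v))\<^sup>2) = (\<Sum>s\<in>{..<m} \<inter> {d v..<d v + N}. (cmod (f v))\<^sup>2)"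
      by (rule sum.mono_neutral_cong_right) (auto simp: window_def)
    also have "\<dots> \<le> (\<Sum>s\<in>{d v..<d v + N}. (cmod (f v))\<^sup>2)"
      by (rule sum_mono2) auto
    finally show "(\<Sum>s<m. (cmod (window N s f v))\<^sup>2) \<le> real N * (cmod (f v))\<^sup>2"
      by simp
  qed
  also have "\<dots> \<le> real N * (l2_norm I f)\<^sup>2"
    using l2_finite_sum_le[OF f finite_levels[of m]] by (simp add: sum_distrib_left[symmetric] mult_left_mono)
  finally show ?thesis .
qed

text \<open>The bound \<open>K\<close> for \<open>A\<close> serves all \<open>N\<close>.
  Cauchy-Schwarz over the \<open>N\<close> windows containing the level of \<open>z\<close> costs
  one factor \<open>N\<close>, and the overlap of the windows counted in
  \<open>sum_window_norm_le\<close> costs another; together they cancel the square of the averaging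
  factor \<open>1 / N\<close>.\<close>

lemma fejer_mean_bound:
  obtains K where "\<forall>N>0. \<forall>f\<in>l2 I. fejer_mean I d N A f \<in> l2 I \<and>
    (l2_norm I (fejer_mean I d N A f))\<^sup>2 \<le> K * (l2_norm I f)\<^sup>2"
proof -
  obtain K where K: "0 \<le> K" "\<forall>f\<in>l2 I. \<forall>F. finite F \<longrightarrow> F \<subseteq> I \<longrightarrow>
      (\<Sum>i\<in>F. (cmod (A f i))\<^sup>2) \<le> K * (l2_norm I f)\<^sup>2"
    using bounded_ops_bound[OF bounded] by blast
  have "(\<Sum>z\<in>F. (cmod (fejer_mean I d N A f z))\<^sup>2) \<le> K * (l2_norm I f)\<^sup>2"
    if N: "0 < N" and f: "f \<in> l2 I" and F: "finite F" "F \<subseteq> I" for N f F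
  proof -
    define a where "a = (\<lambda>s z. (cmod (A (window N s f) z))\<^sup>2)"
    \<comment> \<open>Every window that reaches a level of \<open>F\<close> has index below
      \<open>m\<close>; inserting 0 keeps \<open>Max\<close> meaningful for empty
      \<open>F\<close>.\<close>
    define m where "m = Max (insert 0 (d ` F)) + N"
    have dz: "d z + N \<le> m" if "z \<in> F" for z
      unfolding m_def using F(1) that by (intro add_right_mono Max_ge) auto
    have each: "real N * (cmod (fejer_mean I d N A f z))\<^sup>2 \<le> (\<Sum>s<m. a s z)" if z: "z \<in> F" for z
    proof -
      have "(real N * cmod (fejer_mean I d N A f z))\<^sup>2 = (cmod (\<Sum>s\<in>{d z..<d z + N}. A (window N s f) z))\<^sup>2"
        using fejer_mean_window[OF f _ N, of z] z F(2) by (metis norm_mult norm_of_nat subsetD)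
      also have "\<dots> \<le> (\<Sum>s\<in>{d z..<d z + N}. cmod (A (window N s f) z))\<^sup>2"
        by (intro power_mono norm_sum) auto
      also have "\<dots> \<le> (\<Sum>s\<in>{d z..<d z + N}. a s z) * real (card {d z..<d z + N})"
        unfolding a_def by (rule sum_squared_le_sum_of_squares)
      also have "\<dots> \<le> (\<Sum>s<m. a s z) * real N"
        using dz[OF z] by (intro mult_mono sum_mono2 sum_nonneg) (auto simp: a_def)
      finally show ?thesis
        using N by (simp add: power_mult_distrib power2_eq_square[of "real N"])
    qed
    have "real N * (\<Sum>z\<in>F. (cmod (fejer_mean I d N A f z))\<^sup>2) \<le> (\<Sum>z\<in>F. \<Sum>s<m. a s z)"
      unfolding sum_distrib_left by (rule sum_mono) (rule each)
    also have "\<dots> = (\<Sum>s<m. \<Sum>z\<in>F. a s z)"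
      by (rule sum.swap)
    also have "\<dots> \<le> (\<Sum>s<m. K * (l2_norm I (window N s f))\<^sup>2)"
      using K(2)[rule_format, OF window_l2[OF f] F] by (intro sum_mono) (simp add: a_def)
    also have "\<dots> \<le> K * (real N * (l2_norm I f)\<^sup>2)"
      unfolding sum_distrib_left[symmetric] by (rule mult_left_mono[OF sum_window_norm_le[OF f] K(1)])
    finally have "real N * (\<Sum>z\<in>F. (cmod (fejer_mean I d N A f z))\<^sup>2) \<le> real N * (K * (l2_norm I f)\<^sup>2)"
      by (simp add: mult_ac)
    then show ?thesis
      using N by simp
  qed
  note * = this
  have "fejer_mean I d N A f \<in> l2 I \<and> (l2_norm I (fejer_mean I d N A f))\<^sup>2 \<le> K * (l2_norm I f)\<^sup>2"
    if "0 < N" "f \<in> l2 I" for N f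
    using l2_boundI[OF _ *[OF that]] by (simp add: fejer_mean_def)
  then show ?thesis using that by blast
qed

lemma fejer_mean_weakly_tendsto:
  assumes f: "f \<in> l2 I" and g: "g \<in> l2 I"
  shows "(\<lambda>n. l2_inner I (fejer_mean I d (Suc n) A f) g) \<longlonglongrightarrow> l2_inner I (A f) g"
proof -
  obtain K where K: "\<forall>N>0. \<forall>f\<in>l2 I. fejer_mean I d N A f \<in> l2 I \<and>
      (l2_norm I (fejer_mean I d N A f))\<^sup>2 \<le> K * (l2_norm I f)\<^sup>2"
    by (rule fejer_mean_bound)
  show ?thesis
  proof (rule l2_inner_tendsto[where M = "K * (l2_norm I f)\<^sup>2"])
    fix z assume z: "z \<in> I"
    have "(\<lambda>n. \<Sum>v | v \<in> I \<and> d v \<le> d z. of_real (max 0 (1 - (real (d z) - real (d v)) / real n))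
        * A (\<xi> v) z * f v) \<longlonglongrightarrow>
        (\<Sum>v | v \<in> I \<and> d v \<le> d z. of_real (max 0 (1 - 0)) * A (\<xi> v) z * f v)"
      by (intro tendsto_intros tendsto_of_real tendsto_max lim_const_over_n)
    then have "(\<lambda>n. fejer_mean I d n A f z) \<longlonglongrightarrow> A f z"
      using z apply_eq_sum[OF f z] by (simp add: fejer_mean_def mult.commute)
    \<comment> \<open>The shift to \<open>Suc n\<close> avoids \<open>N = 0\<close>, for which no
      norm bound was established. The limit itself is elementary, since for fixed \<open>z\<close>
      the sum is finite.\<close>
    then show "(\<lambda>n. fejer_mean I d (Suc n) A f z) \<longlonglongrightarrow> A f z"
      by (rule LIMSEQ_Suc)
  qed (use K f g bounded_ops_in_l2[OF bounded f] in auto)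
qed

end

section \<open>The path category\<close>

definition vpath :: "'v \<Rightarrow> ('v, 'e) dpath" where
  "vpath z = (z, [], z)"

definition plen :: "('v, 'e) dpath \<Rightarrow> nat" where
  "plen w = length (fst (snd w))"

lemma src_pcomp [simp]: "src (w \<odot> v) = src v"
  by (simp add: pcomp_def src_def)

lemma rng_pcomp [simp]: "rng (w \<odot> v) = rng w"
  by (simp add: pcomp_def rng_def)

lemma plen_pcomp [simp]: "plen (w \<odot> v) = plen w + plen v"
  by (simp add: pcomp_def plen_def)

lemma src_vpath [simp]: "src (vpath z) = z"
  by (simp add: vpath_def src_def)

lemma rng_vpath [simp]: "rng (vpath z) = z"
  by (simp add: vpath_def rng_def)

lemma pcomp_vpath_src: "w \<odot> vpath (src w) = w"
  by (simp add: pcomp_def vpath_def src_def rng_def)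

lemma vpath_rng_pcomp: "vpath (rng w) \<odot> w = w"
  by (simp add: pcomp_def vpath_def src_def rng_def)

lemma pcomp_cancel_right:
  assumes "w \<in> dpaths G" "w' \<in> dpaths G" "u \<in> dpaths G" "w \<odot> u \<in> dpaths G" "w \<odot> u = w' \<odot> u"
  shows "w = w'"
proof -
  have "src w = src w'"
    using assms pcomp_in_dpaths_iff by metis
  with assms(5) show ?thesis
    by (auto simp: pcomp_def src_def rng_def prod_eq_iff)
qed

context wf_digraph
begin

lemma src_in_verts: "w \<in> dpaths G \<Longrightarrow> src w \<in> verts G"
  by (auto simp: dpaths_def src_def)

lemma rng_in_verts: "w \<in> dpaths G \<Longrightarrow> rng w \<in> verts G"
  by (auto simp: dpaths_def rng_def)

lemma vpath_in_dpaths [simp]: "vpath z \<in> dpaths G \<longleftrightarrow> z \<in> verts G"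
  by (simp add: dpaths_def vpath_def awalk_Nil_iff)

lemma pcomp_eq_right:
  assumes "w \<in> dpaths G" "v \<in> dpaths G" "w \<odot> v = v"
  shows "w = vpath (rng v)"
  by (rule pcomp_cancel_right[of w G _ v]) (use assms in \<open>simp_all add: rng_in_verts vpath_rng_pcomp\<close>)

lemma dpath_split:
  assumes "w \<in> dpaths G" "n \<le> plen w"
  obtains w1 w2 where "w1 \<in> dpaths G" "w2 \<in> dpaths G" "w = w2 \<odot> w1" "plen w1 = n"
proof -
  obtain a p b where w: "w = (a, p, b)" by (cases w)
  have "awalk a (take n p @ drop n p) b"
    using assms(1) by (simp add: w dpaths_def)
  then have *: "awalk a (take n p) (awlast a (take n p))" "awalk (awlast a (take n p)) (drop n p) b"
    unfolding awalk_append_iff by blast+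
  show ?thesis
  proof (rule that[of "(a, take n p, awlast a (take n p))" "(awlast a (take n p), drop n p, b)"])
    show "plen (a, take n p, awlast a (take n p)) = n"
      using assms(2) by (simp add: w plen_def)
  qed (use * in \<open>simp_all add: dpaths_def w pcomp_def src_def rng_def\<close>)
qed

end

lemma (in fin_digraph) finite_dpaths_plen: "finite {w \<in> dpaths G. plen w = n}"
proof (rule finite_subset)
  show "{w \<in> dpaths G. plen w = n} \<subseteq>
      verts G \<times> {p. set p \<subseteq> arcs G \<and> length p = n} \<times> verts G"
  proof
    fix w assume w: "w \<in> {w \<in> dpaths G. plen w = n}"
    obtain a p b where ab: "w = (a, p, b)" by (cases w)
    have "awalk a p b" "length p = n"
      using w by (simp_all add: ab dpaths_def plen_def)
    moreover from this(1) have "set p \<subseteq> arcs G"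
      by (simp add: awalk_def)
    ultimately show "w \<in> verts G \<times> {p. set p \<subseteq> arcs G \<and> length p = n} \<times> verts G"
      using ab by (auto dest: awalk_hd_in_verts awalk_last_in_verts)
  qed
  show "finite (verts G \<times> {p. set p \<subseteq> arcs G \<and> length p = n} \<times> verts G)"
    by (intro finite_cartesian_product finite_lists_length_eq) auto
qed

lemma finite_weight_paths_iff:
  "w \<in> finite_weight_paths G k \<longleftrightarrow> w \<in> dpaths G \<and> (\<exists>c. \<forall>v\<in>dpaths G. k v w \<le> c)"
proof (cases "w \<in> dpaths G")
  case w: True
  have "weight_sup G k w < \<infinity> \<longleftrightarrow> (\<exists>c. \<forall>v\<in>dpaths G. k v w \<le> c)"
  proof
    assume fin: "weight_sup G k w < \<infinity>"
    have le: "ereal (k v w) \<le> weight_sup G k w" if "v \<in> dpaths G" for v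
      unfolding weight_sup_def using that by (rule SUP_upper)
    \<comment> \<open>The path \<open>w\<close> itself shows that the supremum is taken over a
      nonempty set, so it cannot be minus infinity.\<close>
    obtain c where "weight_sup G k w = ereal c"
      using le[OF w] fin by (cases "weight_sup G k w") auto
    with le have "\<forall>v\<in>dpaths G. k v w \<le> c" by simp
    then show "\<exists>c. \<forall>v\<in>dpaths G. k v w \<le> c" ..
  next
    assume "\<exists>c. \<forall>v\<in>dpaths G. k v w \<le> c"
    then obtain c where "\<forall>v\<in>dpaths G. k v w \<le> c" ..
    then have "weight_sup G k w \<le> ereal c"
      unfolding weight_sup_def by (intro SUP_least) simp
    then show "weight_sup G k w < \<infinity>"
      using less_ereal.simps(4) order_le_less_trans by blast
  qed
  with w show ?thesis by (simp add: finite_weight_paths_def)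
qed (simp add: finite_weight_paths_def)


section \<open>Weighted right shifts\<close>

text \<open>The mirror image of \<open>weighted_shift\<close>. By right cancellation the sum has at
  most one term.\<close>

definition weighted_right_shift ::
  "('v, 'e) pre_digraph \<Rightarrow> ('v, 'e) weight \<Rightarrow> ('v, 'e) dpath \<Rightarrow> ('v, 'e) dpath op" where
  "weighted_right_shift G rho u = (\<lambda>f\<in>l2 (dpaths G). \<lambda>z.
     if z \<in> dpaths G then \<Sum>v | v \<in> dpaths G \<and> v \<odot> u = z. complex_of_real (rho v u) * f v else 0)"

lemma weighted_right_shift_pcomp:
  assumes "f \<in> l2 (dpaths G)" "v \<in> dpaths G" "u \<in> dpaths G" "v \<odot> u \<in> dpaths G"
  shows "weighted_right_shift G rho u f (v \<odot> u) = complex_of_real (rho v u) * f v"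
proof -
  have "{v'. v' \<in> dpaths G \<and> v' \<odot> u = v \<odot> u} = {v}"
  proof (intro set_eqI iffI)
    fix v' assume "v' \<in> {v'. v' \<in> dpaths G \<and> v' \<odot> u = v \<odot> u}"
    then have "v' \<in> dpaths G" "v \<odot> u = v' \<odot> u" by simp_all
    then show "v' \<in> {v}"
      using pcomp_cancel_right[OF assms(2) _ assms(3,4)] by simp
  qed (use assms(2) in simp)
  then show ?thesis
    using assms(1,4) by (simp add: weighted_right_shift_def)
qed

lemma weighted_right_shift_eq_0:
  assumes "f \<in> l2 (dpaths G)" "\<And>v. v \<in> dpaths G \<Longrightarrow> z \<in> dpaths G \<Longrightarrow> v \<odot> u \<noteq> z"
  shows "weighted_right_shift G rho u f z = 0"
  unfolding weighted_right_shift_def using assms by (auto intro!: sum.neutral)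

lemma weighted_right_shift_basis:
  assumes v: "v \<in> dpaths G" and u: "u \<in> dpaths G"
  shows "weighted_right_shift G rho u (\<xi> v) =
    (if v \<odot> u \<in> dpaths G then (\<lambda>z. complex_of_real (rho v u) * \<xi> (v \<odot> u) z) else (\<lambda>_. 0))"
proof
  fix z
  note b = basis_vec_in_l2[OF v]
  show "weighted_right_shift G rho u (\<xi> v) z =
    (if v \<odot> u \<in> dpaths G then (\<lambda>z. complex_of_real (rho v u) * \<xi> (v \<odot> u) z) else (\<lambda>_. 0)) z"
  proof (cases "\<exists>v'. v' \<in> dpaths G \<and> v' \<odot> u = z \<and> z \<in> dpaths G")
    case True
    then obtain v' where v': "v' \<in> dpaths G" "v' \<odot> u = z" "v' \<odot> u \<in> dpaths G" by auto
    have "v' \<odot> u = v \<odot> u \<longleftrightarrow> v = v'"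
      using pcomp_cancel_right[OF v'(1) v u v'(3)] by auto
    with v' weighted_right_shift_pcomp[OF b v'(1) u v'(3), of rho] show ?thesis
      by (auto simp: basis_vec_def)
  next
    case False
    then have "z \<noteq> v \<odot> u" if "v \<odot> u \<in> dpaths G"
      using that v by blast
    with weighted_right_shift_eq_0[OF b, of z u rho] False show ?thesis
      by (auto simp: basis_vec_def)
  qed
qed

lemma weighted_right_shift_bounded:
  assumes nonneg: "\<And>v. v \<in> dpaths G \<Longrightarrow> 0 \<le> rho v u" and u: "u \<in> finite_weight_paths G rho"
  shows "weighted_right_shift G rho u \<in> bounded_ops (dpaths G)"
proof -
  let ?P = "dpaths G" and ?R = "weighted_right_shift G rho u"
  obtain c where c: "\<forall>v\<in>?P. rho v u \<le> c" and uP: "u \<in> ?P"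
    using u unfolding finite_weight_paths_iff by blast
  show ?thesis
  proof (rule bounded_opsI[where K = "c\<^sup>2"])
    show "?R \<in> extensional (l2 ?P)"
      by (simp add: weighted_right_shift_def)
  next
    fix f g assume "f \<in> l2 ?P" "g \<in> l2 ?P"
    then show "?R (\<lambda>i. f i + g i) = (\<lambda>i. ?R f i + ?R g i)"
      using l2_add(1)[of f ?P g] by (auto simp: weighted_right_shift_def ring_distribs sum.distrib)
  next
    fix a f assume "f \<in> l2 ?P"
    then show "?R (\<lambda>i. a * f i) = (\<lambda>i. a * ?R f i)"
      using l2_scale[of f ?P a] by (auto simp: weighted_right_shift_def sum_distrib_left mult_ac)
  next
    fix f z assume "f \<in> l2 ?P" "z \<notin> ?P"
    then show "?R f z = 0"
      by (simp add: weighted_right_shift_def)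
  next
    fix f F assume f: "f \<in> l2 ?P" and F: "finite F" "F \<subseteq> ?P"
    define E where "E = {v \<in> ?P. v \<odot> u \<in> F}"
    have inj: "inj_on (\<lambda>v. v \<odot> u) E"
      using pcomp_cancel_right[OF _ _ uP] F(2) unfolding E_def inj_on_def by blast
    have img: "(\<lambda>v. v \<odot> u) ` E \<subseteq> F" by (auto simp: E_def)
    have E: "finite E" "E \<subseteq> ?P"
      using finite_imageD[OF finite_subset[OF img F(1)] inj] by (auto simp: E_def)
    have "(\<Sum>z\<in>F. (cmod (?R f z))\<^sup>2) = (\<Sum>z\<in>(\<lambda>v. v \<odot> u) ` E. (cmod (?R f z))\<^sup>2)"
    proof (rule sum.mono_neutral_right[OF F(1) img], intro ballI)
      fix z assume "z \<in> F - (\<lambda>v. v \<odot> u) ` E"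
      then have "?R f z = 0"
        by (intro weighted_right_shift_eq_0[OF f]) (auto simp: E_def)
      then show "(cmod (?R f z))\<^sup>2 = 0" by simp
    qed
    also have "\<dots> = (\<Sum>v\<in>E. (cmod (?R f (v \<odot> u)))\<^sup>2)"
      by (simp add: sum.reindex[OF inj])
    also have "\<dots> \<le> (\<Sum>v\<in>E. c\<^sup>2 * (cmod (f v))\<^sup>2)"
    proof (rule sum_mono)
      fix v assume v: "v \<in> E"
      then have vP: "v \<in> ?P" "v \<odot> u \<in> ?P"
        using F(2) by (auto simp: E_def)
      have "(rho v u)\<^sup>2 \<le> c\<^sup>2"
        using c nonneg[OF vP(1)] vP(1) by (intro power_mono) auto
      then show "(cmod (?R f (v \<odot> u)))\<^sup>2 \<le> c\<^sup>2 * (cmod (f v))\<^sup>2"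
        unfolding weighted_right_shift_pcomp[OF f vP(1) uP vP(2)]
        by (simp add: norm_mult power_mult_distrib mult_right_mono)
    qed
    also have "\<dots> \<le> c\<^sup>2 * (l2_norm ?P f)\<^sup>2"
      using l2_finite_sum_le[OF f E] by (simp add: sum_distrib_left[symmetric] mult_left_mono)
    finally show "(\<Sum>z\<in>F. (cmod (?R f z))\<^sup>2) \<le> c\<^sup>2 * (l2_norm ?P f)\<^sup>2" .
  qed
qed


section \<open>Left-bounded weights with a right companion\<close>

lemma unital_operator_algebra_sum:
  assumes \<A>: "unital_operator_algebra I \<A>" and "finite F" "\<And>w. w \<in> F \<Longrightarrow> S w \<in> \<A>"
  shows "(\<lambda>f\<in>l2 I. \<lambda>z. \<Sum>w\<in>F. c w * S w f z) \<in> \<A>"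
  using assms(2,3)
proof (induction F rule: finite_induct)
  case empty
  have "op_scale I 0 (op_id I) \<in> \<A>"
    using \<A> by (simp add: unital_operator_algebra_def)
  moreover have "op_scale I 0 (op_id I) = (\<lambda>f\<in>l2 I. \<lambda>z. \<Sum>w\<in>{}. c w * S w f z)"
    unfolding op_scale_def by (rule restrict_ext) simp
  ultimately show ?case by (simp only:)
next
  case (insert w F)
  have "op_add I (op_scale I (c w) (S w)) (\<lambda>f\<in>l2 I. \<lambda>z. \<Sum>w\<in>F. c w * S w f z) \<in> \<A>"
  proof -
    have "(\<lambda>f\<in>l2 I. \<lambda>z. \<Sum>w\<in>F. c w * S w f z) \<in> \<A>"
      by (rule insert.IH) (simp add: insert.prems)
    then show ?thesis
      using \<A> insert.prems[of w] unfolding unital_operator_algebra_def by blast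
  qed
  moreover have "op_add I (op_scale I (c w) (S w)) (\<lambda>f\<in>l2 I. \<lambda>z. \<Sum>w\<in>F. c w * S w f z) =
      (\<lambda>f\<in>l2 I. \<lambda>z. \<Sum>w\<in>insert w F. c w * S w f z)"
    unfolding op_add_def op_scale_def by (rule restrict_ext) (simp add: insert.hyps)
  ultimately show ?case by (simp only:)
qed

locale companion_weights = fin_digraph G for G :: "('v, 'e) pre_digraph" +
  fixes lam rho :: "('v, 'e) weight"
  assumes left: "left_weight G lam" "left_bounded G lam"
    and companion: "right_companion G lam rho"
begin

abbreviation "L \<equiv> weighted_shift G lam"
abbreviation "R \<equiv> weighted_right_shift G rho"

lemma right: "right_weight G rho"
  using companion by (simp add: right_companion_def)

lemma lam_pos: "v \<in> dpaths G \<Longrightarrow> w \<in> dpaths G \<Longrightarrow> src w = rng v \<Longrightarrow> 0 < lam v w"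
  using left(1) by (simp add: left_weight_def pcomp_in_dpaths_iff)

lemma lam_pcomp:
  assumes "v \<in> dpaths G" "w1 \<in> dpaths G" "w2 \<in> dpaths G" "src w2 = rng w1" "src w1 = rng v"
  shows "lam v (w2 \<odot> w1) = lam (w1 \<odot> v) w2 * lam v w1"
  using left(1) assms by (simp add: left_weight_def pcomp_in_dpaths_iff)

text \<open>A vertex is idempotent, so the cocycle identity makes its weight a positive solution of
  \<open>t = t * t\<close>.\<close>

lemma lam_vpath:
  assumes "v \<in> dpaths G"
  shows "lam v (vpath (rng v)) = 1"
proof -
  let ?b = "vpath (rng v) :: ('v, 'e) dpath"
  have b: "?b \<in> dpaths G"
    using assms by (simp add: rng_in_verts)
  have "lam v (?b \<odot> ?b) = lam (?b \<odot> v) ?b * lam v ?b"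
    using lam_pcomp[OF assms b b] by simp
  moreover have "?b \<odot> ?b = ?b" "?b \<odot> v = v"
    using vpath_rng_pcomp[of ?b] vpath_rng_pcomp[of v] by simp_all
  ultimately show ?thesis
    using lam_pos[OF assms b] by (simp only: src_vpath mult_cancel_right1) simp
qed

lemma lam_bounded:
  assumes "w \<in> dpaths G"
  shows "\<exists>c. \<forall>v\<in>dpaths G. lam v w \<le> c"
  using assms left(2) finite_weight_paths_iff[of w G lam]
  by (simp add: left_bounded_def finite_weight_paths_def)

lemma finite_weight_lam: "finite_weight_paths G lam = dpaths G"
  using left(2) by (auto simp: left_bounded_def finite_weight_paths_def)

lemma rho_nonneg: "v \<in> dpaths G \<Longrightarrow> u \<in> dpaths G \<Longrightarrow> 0 \<le> rho v u"
  using right by (simp add: right_weight_def)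

lemma rho_pos: "v \<in> dpaths G \<Longrightarrow> u \<in> dpaths G \<Longrightarrow> src v = rng u \<Longrightarrow> 0 < rho v u"
  using right by (simp add: right_weight_def pcomp_in_dpaths_iff)

lemma rho_eq_0:
  assumes "v \<in> dpaths G" "u \<in> dpaths G" "src v \<noteq> rng u"
  shows "rho v u = 0"
proof -
  have "\<not> 0 < rho v u"
    using right assms by (simp add: right_weight_def pcomp_in_dpaths_iff)
  then show ?thesis
    using rho_nonneg[OF assms(1,2)] by simp
qed

lemma rho_pcomp:
  assumes "v \<in> dpaths G" "u1 \<in> dpaths G" "u2 \<in> dpaths G" "src v = rng u1" "src u1 = rng u2"
  shows "rho v (u1 \<odot> u2) = rho (v \<odot> u1) u2 * rho v u1"
  using right assms by (simp add: right_weight_def pcomp_in_dpaths_iff)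

lemma rho_vpath:
  assumes "v \<in> dpaths G"
  shows "rho v (vpath (src v)) = 1"
proof -
  let ?b = "vpath (src v) :: ('v, 'e) dpath"
  have b: "?b \<in> dpaths G"
    using assms by (simp add: src_in_verts)
  have "rho v (?b \<odot> ?b) = rho (v \<odot> ?b) ?b * rho v ?b"
    using rho_pcomp[OF assms b b] by simp
  moreover have "?b \<odot> ?b = ?b" "v \<odot> ?b = v"
    using vpath_rng_pcomp[of ?b] pcomp_vpath_src[of v] by simp_all
  ultimately show ?thesis
    using rho_pos[OF assms b] by (simp only: rng_vpath mult_cancel_right1) simp
qed

lemma rho_lam:
  assumes "v \<in> dpaths G" "w \<in> dpaths G" "u \<in> dpaths G" "src w = rng v" "src v = rng u"
  shows "rho (w \<odot> v) u * lam v w = lam (v \<odot> u) w * rho v u"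
  using companion assms by (simp add: right_companion_def pcomp_in_dpaths_iff)

lemma vpath_finite_weight:
  assumes "z \<in> verts G"
  shows "vpath z \<in> finite_weight_paths G rho"
proof -
  have "rho v (vpath z) \<le> 1" if "v \<in> dpaths G" for v
    using rho_vpath[OF that] rho_eq_0[OF that, of "vpath z"] assms by (cases "src v = z") auto
  then show ?thesis
    unfolding finite_weight_paths_iff using assms vpath_in_dpaths by blast
qed

text \<open>The cocycle identity makes the supremum of the right weight submultiplicative.\<close>

lemma pcomp_finite_weight:
  assumes u: "u1 \<in> finite_weight_paths G rho" "u2 \<in> finite_weight_paths G rho" "src u1 = rng u2"
  shows "u1 \<odot> u2 \<in> finite_weight_paths G rho"
proof -
  obtain c1 c2 where c: "\<forall>v\<in>dpaths G. rho v u1 \<le> c1" "\<forall>v\<in>dpaths G. rho v u2 \<le> c2"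
    and uP: "u1 \<in> dpaths G" "u2 \<in> dpaths G"
    using u unfolding finite_weight_paths_iff by blast
  have uu: "u1 \<odot> u2 \<in> dpaths G"
    using uP u(3) by (simp add: pcomp_in_dpaths_iff)
  have "rho v (u1 \<odot> u2) \<le> \<bar>c2\<bar> * \<bar>c1\<bar>" if v: "v \<in> dpaths G" for v
  proof (cases "src v = rng u1")
    case True
    then have vu: "v \<odot> u1 \<in> dpaths G" using v uP by (simp add: pcomp_in_dpaths_iff)
    have "rho (v \<odot> u1) u2 * rho v u1 \<le> \<bar>c2\<bar> * \<bar>c1\<bar>"
      using c(1)[rule_format, OF v] c(2)[rule_format, OF vu] rho_nonneg[OF v uP(1)] rho_nonneg[OF vu uP(2)]
      by (intro mult_mono) linarith+
    then show ?thesis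
      using rho_pcomp[OF v uP True u(3)] by simp
  next
    case False
    then show ?thesis using rho_eq_0[OF v uu] by simp
  qed
  then show ?thesis
    using uu unfolding finite_weight_paths_iff by blast
qed

section \<open>The generated algebra and the right shifts in its commutant\<close>

lemma L_bounded: "w \<in> dpaths G \<Longrightarrow> L w \<in> bounded_ops (dpaths G)"
  using weighted_shift_bounded[OF left(1)] by (simp add: finite_weight_lam)

lemma R_bounded: "u \<in> finite_weight_paths G rho \<Longrightarrow> R u \<in> bounded_ops (dpaths G)"
  using rho_nonneg by (intro weighted_right_shift_bounded) (auto simp: finite_weight_paths_def)

lemma L_in_algebra: "w \<in> dpaths G \<Longrightarrow> L w \<in> \<LL> G lam"
  unfolding weighted_graph_algebra_def wot_closed_algebra_generated_def finite_weight_lam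
  by (intro hull_inc imageI)

text \<open>The only access to all elements of the algebra: a property passes from the generators to
  every element once the operators having it form a weakly closed unital algebra.\<close>

lemma algebra_minimal:
  assumes "\<And>w. w \<in> dpaths G \<Longrightarrow> L w \<in> \<A>"
    and "unital_operator_algebra (dpaths G) \<A>" "closedin (weak_operator_topology_on (dpaths G)) \<A>"
  shows "\<LL> G lam \<subseteq> \<A>"
  unfolding weighted_graph_algebra_def finite_weight_lam
  by (rule wot_closed_algebra_generated_minimal) (use assms in auto)

lemma algebra_bounded: "\<LL> G lam \<subseteq> bounded_ops (dpaths G)"
  by (rule algebra_minimal[OF L_bounded bounded_ops_algebra])
     (use closedin_topspace[of "weak_operator_topology_on (dpaths G)"] in simp_all)

lemma algebra_in_double_commutant: "\<LL> G lam \<subseteq> commutant (dpaths G) (commutant (dpaths G) (\<LL> G lam))"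
  using algebra_bounded by (auto simp: commutant_def)

lemma L_R_commute:
  assumes w: "w \<in> dpaths G" and u: "u \<in> finite_weight_paths G rho"
  shows "op_mult (dpaths G) (L w) (R u) = op_mult (dpaths G) (R u) (L w)"
proof (rule bounded_ops_eqI)
  have uP: "u \<in> dpaths G" using u by (simp add: finite_weight_paths_def)
  fix v z assume v: "v \<in> dpaths G" and z: "z \<in> dpaths G"
  note b = basis_vec_in_l2[OF v]
  have "L w (R u (\<xi> v)) = R u (L w (\<xi> v))"
  proof (cases "src v = rng u \<and> src w = rng v")
    case True
    then have vu: "v \<odot> u \<in> dpaths G" and wv: "w \<odot> v \<in> dpaths G"
      and wvu: "w \<odot> v \<odot> u \<in> dpaths G" "(w \<odot> v) \<odot> u \<in> dpaths G"
      using v w uP by (simp_all add: pcomp_in_dpaths_iff)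
    have "L w (R u (\<xi> v)) = (\<lambda>z. rho v u * (lam (v \<odot> u) w * \<xi> (w \<odot> v \<odot> u) z))"
      using bounded_ops_scale[OF L_bounded[OF w] basis_vec_in_l2[OF vu], of "rho v u"] vu wvu
      by (simp add: weighted_right_shift_basis[OF v uP] weighted_shift_basis[OF vu w])
    moreover have "R u (L w (\<xi> v)) = (\<lambda>z. lam v w * (rho (w \<odot> v) u * \<xi> (w \<odot> v \<odot> u) z))"
      using bounded_ops_scale[OF R_bounded[OF u] basis_vec_in_l2[OF wv], of "lam v w"] wv wvu
      by (simp add: weighted_right_shift_basis[OF wv uP] weighted_shift_basis[OF v w] pcomp_assoc)
    moreover have "complex_of_real (rho v u) * lam (v \<odot> u) w = lam v w * rho (w \<odot> v) u"
      using rho_lam[OF v w uP] True by (simp flip: of_real_mult add: mult.commute)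
    ultimately show ?thesis by (simp add: mult.assoc[symmetric])
  next
    case False
    note zero = bounded_ops_zero[OF L_bounded[OF w]] bounded_ops_zero[OF R_bounded[OF u]]
    have "L w (R u (\<xi> v)) = (\<lambda>_. 0)"
    proof (cases "v \<odot> u \<in> dpaths G")
      case True
      with False have "w \<odot> v \<odot> u \<notin> dpaths G"
        using v w uP by (auto simp: pcomp_in_dpaths_iff)
      then show ?thesis
        using bounded_ops_scale[OF L_bounded[OF w] basis_vec_in_l2[OF True], of "rho v u"] True
        by (simp add: weighted_right_shift_basis[OF v uP] weighted_shift_basis[OF True w])
    qed (simp add: weighted_right_shift_basis[OF v uP] zero)
    moreover have "R u (L w (\<xi> v)) = (\<lambda>_. 0)"
    proof (cases "w \<odot> v \<in> dpaths G")
      case True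
      with False have "(w \<odot> v) \<odot> u \<notin> dpaths G"
        using v w uP True by (auto simp: pcomp_in_dpaths_iff)
      then show ?thesis
        using bounded_ops_scale[OF R_bounded[OF u] basis_vec_in_l2[OF True], of "lam v w"] True
        by (simp add: weighted_right_shift_basis[OF True uP] weighted_shift_basis[OF v w])
    qed (simp add: weighted_shift_basis[OF v w] zero)
    ultimately show ?thesis by simp
  qed
  then show "op_mult (dpaths G) (L w) (R u) (\<xi> v) z = op_mult (dpaths G) (R u) (L w) (\<xi> v) z"
    by (simp add: op_mult_apply[OF b])
qed (use L_bounded[OF w] R_bounded[OF u] op_mult_bounded in auto)

text \<open>Commuting with the generators is enough, because the commutant of \<open>{R u}\<close>
  is itself a weakly closed unital algebra.\<close>

lemma R_in_commutant:
  assumes u: "u \<in> finite_weight_paths G rho"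
  shows "R u \<in> commutant (dpaths G) (\<LL> G lam)"
proof -
  have R: "{R u} \<subseteq> bounded_ops (dpaths G)"
    using R_bounded[OF u] by simp
  have "\<LL> G lam \<subseteq> commutant (dpaths G) {R u}"
  proof (rule algebra_minimal[OF _ commutant_algebra[OF R] closedin_commutant[OF R]])
    fix w assume "w \<in> dpaths G"
    then show "L w \<in> commutant (dpaths G) {R u}"
      using L_bounded L_R_commute[OF _ u] by (simp add: commutant_def)
  qed
  then show ?thesis
    using R_bounded[OF u] by (auto simp: commutant_def)
qed

end

section \<open>The double commutant\<close>

context companion_weights
begin

text \<open>\<open>R u\<close> sends \<open>\<xi> v\<close> to a positive multiple of
  \<open>\<xi> (v \<odot> u)\<close>, and its range lives on the paths that begin with
  \<open>u\<close>. So the column of \<open>A\<close> at \<open>v \<odot> u\<close> is the column at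
  \<open>v\<close>, translated by \<open>u\<close> and reweighted, and it has no other
  entries.\<close>

lemma commutes_R_entries:
  assumes A: "A \<in> bounded_ops (dpaths G)"
    and comm: "op_mult (dpaths G) A (R u) = op_mult (dpaths G) (R u) A"
    and u: "u \<in> dpaths G" and v: "v \<in> dpaths G" "src v = rng u"
  shows "z \<in> dpaths G \<Longrightarrow> src z = rng u \<Longrightarrow>
      complex_of_real (rho v u) * A (\<xi> (v \<odot> u)) (z \<odot> u) = complex_of_real (rho z u) * A (\<xi> v) z"
    and "(\<And>w. w \<in> dpaths G \<Longrightarrow> y \<in> dpaths G \<Longrightarrow> w \<odot> u \<noteq> y) \<Longrightarrow> A (\<xi> (v \<odot> u)) y = 0"
proof -
  have vu: "v \<odot> u \<in> dpaths G"
    using u v by (simp add: pcomp_in_dpaths_iff)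
  note b = basis_vec_in_l2[OF v(1)] and Ab = bounded_ops_in_l2[OF A basis_vec_in_l2[OF v(1)]]
  have "A (R u (\<xi> v)) = R u (A (\<xi> v))"
    using comm b unfolding op_mult_eq_iff by blast
  moreover have "A (R u (\<xi> v)) = (\<lambda>i. complex_of_real (rho v u) * A (\<xi> (v \<odot> u)) i)"
    using bounded_ops_scale[OF A basis_vec_in_l2[OF vu]] vu
    by (simp add: weighted_right_shift_basis[OF v(1) u])
  ultimately have eq: "complex_of_real (rho v u) * A (\<xi> (v \<odot> u)) i = R u (A (\<xi> v)) i" for i
    by metis
  show "complex_of_real (rho v u) * A (\<xi> (v \<odot> u)) (z \<odot> u) = complex_of_real (rho z u) * A (\<xi> v) z"
    if "z \<in> dpaths G" "src z = rng u"
    using eq weighted_right_shift_pcomp[OF Ab that(1) u, of rho] that u by (simp add: pcomp_in_dpaths_iff)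
  show "A (\<xi> (v \<odot> u)) y = 0" if "\<And>w. w \<in> dpaths G \<Longrightarrow> y \<in> dpaths G \<Longrightarrow> w \<odot> u \<noteq> y"
    using eq[of y] weighted_right_shift_eq_0[OF Ab that, of rho] rho_pos[OF v(1) u v(2)] by simp
qed

text \<open>Reads off \<open>a_w\<close> from the formal series of \<open>A\<close>: among all
  \<open>L w'\<close>, only \<open>L w\<close> maps the source vertex of \<open>w\<close> to a
  multiple of \<open>\<xi> w\<close>, and the factor is the positive number divided by here.\<close>

definition fourier_coeff :: "('v, 'e) dpath op \<Rightarrow> ('v, 'e) dpath \<Rightarrow> complex" where
  "fourier_coeff A w = A (\<xi> (vpath (src w))) w / complex_of_real (lam (vpath (src w)) w)"

text \<open>
  If \<open>u\<close> and \<open>v \<odot> u\<close> have finite right weight, commutation with \<open>R (v \<odot> u)\<close> expresses \<open>A (\<xi> (v \<odot> u))\<close>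
  through \<open>A (\<xi> (vpath (rng v)))\<close>, and commutation with the injective \<open>R u\<close> transfers this to \<open>A (\<xi> v)\<close>.
\<close>

lemma matrix_of_double_commutant:
  assumes dense: "\<forall>v\<in>dpaths G. \<exists>u\<in>finite_weight_paths G rho. v \<odot> u \<in> finite_weight_paths G rho"
    and A: "A \<in> bounded_ops (dpaths G)"
    and comm: "\<And>u. u \<in> finite_weight_paths G rho \<Longrightarrow>
      op_mult (dpaths G) A (R u) = op_mult (dpaths G) (R u) A"
    and v: "v \<in> dpaths G"
  shows "w \<in> dpaths G \<Longrightarrow> src w = rng v \<Longrightarrow>
      A (\<xi> v) (w \<odot> v) = fourier_coeff A w * complex_of_real (lam v w)"
    and "z \<in> dpaths G \<Longrightarrow> (\<And>w. w \<in> dpaths G \<Longrightarrow> w \<odot> v \<noteq> z) \<Longrightarrow> A (\<xi> v) z = 0"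
proof -
  obtain u where u: "u \<in> finite_weight_paths G rho" "v \<odot> u \<in> finite_weight_paths G rho"
    using dense v by blast
  define q where "q = v \<odot> u"
  define b where "b = (vpath (rng v) :: ('v, 'e) dpath)"
  have uP: "u \<in> dpaths G" and q: "q \<in> dpaths G" "q \<in> finite_weight_paths G rho"
    using u by (simp_all add: finite_weight_paths_def q_def)
  have vu: "src v = rng u"
    using q(1) uP v by (simp add: q_def pcomp_in_dpaths_iff)
  have b: "b \<in> dpaths G" "src b = rng q" "b \<odot> q = q"
    using v vpath_rng_pcomp[of q] by (simp_all add: b_def q_def rng_in_verts)
  note via_q = commutes_R_entries[OF A comm[OF q(2)] q(1) b(1,2), unfolded b(3)]
  note via_u = commutes_R_entries[OF A comm[OF u(1)] uP v vu]
  show "A (\<xi> v) (w \<odot> v) = fourier_coeff A w * complex_of_real (lam v w)"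
    if w: "w \<in> dpaths G" "src w = rng v"
  proof -
    have wv: "w \<odot> v \<in> dpaths G"
      using w v by (simp add: pcomp_in_dpaths_iff)
    have wb: "w \<odot> b = w" "rng b = src w"
      using w(2) pcomp_vpath_src[of w] by (simp_all add: b_def)
    have pos: "0 < lam b w" "0 < rho b q" "0 < rho (w \<odot> v) u"
      using lam_pos[OF b(1) w(1)] rho_pos[OF b(1) q(1) b(2)] rho_pos[OF wv uP] wb vu by simp_all
    have coeff: "A (\<xi> b) w = fourier_coeff A w * complex_of_real (lam b w)"
      using pos(1) w(2) by (simp add: fourier_coeff_def b_def)
    have q1: "complex_of_real (rho b q) * A (\<xi> q) (w \<odot> q) = complex_of_real (rho w q) * A (\<xi> b) w"
      using via_q(1)[OF w(1)] w(2) by (simp add: q_def)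
    have "rho w q * lam b w = lam q w * rho b q"
      using rho_lam[OF b(1) w(1) q(1)] b wb by simp
    then have "complex_of_real (rho w q) * complex_of_real (lam b w) =
        complex_of_real (lam q w) * complex_of_real (rho b q)"
      by (simp flip: of_real_mult)
    then have "complex_of_real (rho b q) * A (\<xi> q) (w \<odot> q) =
        complex_of_real (rho b q) * (complex_of_real (lam q w) * fourier_coeff A w)"
      unfolding q1 coeff by (simp add: mult_ac)
    then have q2: "A (\<xi> q) (w \<odot> q) = complex_of_real (lam q w) * fourier_coeff A w"
      using pos(2) by simp
    have "complex_of_real (rho v u) * A (\<xi> q) (w \<odot> q) =
        complex_of_real (rho (w \<odot> v) u) * A (\<xi> v) (w \<odot> v)"
      using via_u(1)[OF wv] vu by (simp add: q_def pcomp_assoc)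
    moreover have "rho (w \<odot> v) u * lam v w = lam q w * rho v u"
      using rho_lam[OF v w(1) uP w(2) vu] by (simp add: q_def)
    then have "complex_of_real (rho (w \<odot> v) u) * complex_of_real (lam v w) =
        complex_of_real (lam q w) * complex_of_real (rho v u)"
      by (simp flip: of_real_mult)
    ultimately have "complex_of_real (rho (w \<odot> v) u) * A (\<xi> v) (w \<odot> v) =
        complex_of_real (rho (w \<odot> v) u) * (fourier_coeff A w * complex_of_real (lam v w))"
      unfolding q2 by (metis mult.assoc mult.commute)
    then show ?thesis
      using pos(3) by simp
  qed
  show "A (\<xi> v) z = 0" if z: "z \<in> dpaths G" and nz: "\<And>w. w \<in> dpaths G \<Longrightarrow> w \<odot> v \<noteq> z"
  proof (cases "src z = src v")
    case True
    \<comment> \<open>Were \<open>z \<odot> u\<close> of the form \<open>w \<odot> q\<close>,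
      cancelling \<open>u\<close> would make \<open>z\<close> equal to \<open>w \<odot> v\<close>.
      So the entry vanishes in column \<open>q\<close>, and \<open>R u\<close> carries this back to
      column \<open>v\<close>.\<close>
    have "A (\<xi> q) (z \<odot> u) = 0"
    proof (rule via_q(2))
      fix w assume w: "w \<in> dpaths G" and zu: "z \<odot> u \<in> dpaths G"
      show "w \<odot> q \<noteq> z \<odot> u"
      proof
        assume eq: "w \<odot> q = z \<odot> u"
        then have "src w = rng q"
          using zu w q(1) pcomp_in_dpaths_iff by metis
        then have "w \<odot> v \<in> dpaths G"
          using w v by (simp add: q_def pcomp_in_dpaths_iff)
        then have "z = w \<odot> v"
          by (rule pcomp_cancel_right[OF z _ uP zu]) (simp add: eq[symmetric] q_def pcomp_assoc)
        with nz[OF w] show False by simp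
      qed
    qed
    then have "complex_of_real (rho z u) * A (\<xi> v) z = 0"
      using via_u(1)[OF z] True vu by (simp add: q_def)
    then show ?thesis
      using rho_pos[OF z uP] True vu by simp
  next
    case False
    \<comment> \<open>Here \<open>z\<close> cannot be extended by \<open>u\<close>. Commutation with
      the projection \<open>R (vpath (src v))\<close> applies instead: it confines the column of
      \<open>v\<close> to paths with the same source.\<close>
    have s: "vpath (src v) \<in> finite_weight_paths G rho" "vpath (src v) \<in> dpaths G"
      using v by (simp_all add: src_in_verts vpath_finite_weight)
    have "A (\<xi> (v \<odot> vpath (src v))) z = 0"
      by (rule commutes_R_entries(2)[OF A comm[OF s(1)] s(2) v]) (use False in auto)
    then show ?thesis by (simp add: pcomp_vpath_src)
  qed
qed

text \<open>Length is additive, so at an entry \<open>(v, w \<odot> v)\<close> the Fejer kernel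
  depends on \<open>plen w\<close> alone. It therefore only rescales the coefficients
  \<open>a w\<close>, and the Fejer mean is a combination of the operators
  \<open>L w\<close>.\<close>

lemma in_algebra_of_matrix:
  assumes A: "A \<in> bounded_ops (dpaths G)"
    and coeff: "\<And>v w. v \<in> dpaths G \<Longrightarrow> w \<in> dpaths G \<Longrightarrow> src w = rng v \<Longrightarrow>
      A (\<xi> v) (w \<odot> v) = a w * complex_of_real (lam v w)"
    and zero: "\<And>v z. v \<in> dpaths G \<Longrightarrow> z \<in> dpaths G \<Longrightarrow>
      (\<And>w. w \<in> dpaths G \<Longrightarrow> w \<odot> v \<noteq> z) \<Longrightarrow> A (\<xi> v) z = 0"
  shows "A \<in> \<LL> G lam"
proof -
  let ?P = "dpaths G"
  interpret triangular_operator ?P plen A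
  proof
    show "plen v \<le> plen z" if "v \<in> ?P" "z \<in> ?P" "A (\<xi> v) z \<noteq> 0" for v z
      using zero[OF that(1,2)] that(3) by fastforce
  qed (use A finite_dpaths_plen in auto)
  define c where "c = (\<lambda>n w. complex_of_real (max 0 (1 - real (plen w) / real (Suc n))) * a w)"
  \<comment> \<open>The kernel for \<open>Suc n\<close> vanishes as soon as \<open>plen w\<close>
    exceeds \<open>n\<close>, so cutting the sum at \<open>n\<close> discards only zero
    coefficients.\<close>
  define B where "B = (\<lambda>n. \<lambda>f\<in>l2 ?P. \<lambda>z. \<Sum>w | w \<in> ?P \<and> plen w \<le> n. c n w * L w f z)"
  have B_eq: "B n f = fejer_mean ?P plen (Suc n) A f" if f: "f \<in> l2 ?P" for n f
  proof
    fix z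
    let ?F = "{w \<in> ?P. plen w \<le> n}"
    show "B n f z = fejer_mean ?P plen (Suc n) A f z"
    proof (cases "z \<in> ?P")
      case False
      then have "L w f z = 0" if "w \<in> ?P" for w
        using bounded_ops_outside[OF L_bounded[OF that] f] by blast
      with False f show ?thesis
        by (simp add: B_def fejer_mean_def)
    next
      case z: True
      let ?W = "{v \<in> ?P. plen v \<le> plen z}"
      have "L w f z = (\<Sum>v\<in>?W. if w \<odot> v = z then complex_of_real (lam v w) * f v else 0)" for w
      proof -
        have "L w f z = (\<Sum>v | v \<in> ?P \<and> w \<odot> v = z. complex_of_real (lam v w) * f v)"
          using f z by (simp add: weighted_shift_def)
        also have "\<dots> = (\<Sum>v\<in>?W. if w \<odot> v = z then complex_of_real (lam v w) * f v else 0)"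
          by (rule sum.mono_neutral_cong_left[OF finite_levels]) auto
        finally show ?thesis .
      qed
      then have "B n f z =
          (\<Sum>w\<in>?F. \<Sum>v\<in>?W. if w \<odot> v = z then c n w * (complex_of_real (lam v w) * f v) else 0)"
        using f by (simp add: B_def sum_distrib_left if_distrib cong: if_cong)
      also have "\<dots> =
          (\<Sum>v\<in>?W. \<Sum>w\<in>?F. if w \<odot> v = z then c n w * (complex_of_real (lam v w) * f v) else 0)"
        by (rule sum.swap)
      also have "\<dots> = (\<Sum>v\<in>?W. of_real (max 0 (1 - (real (plen z) - real (plen v)) / real (Suc n)))
          * A (\<xi> v) z * f v)"
      proof (rule sum.cong[OF refl])
        fix v assume "v \<in> ?W"
        then have v: "v \<in> ?P" by simp
        let ?k = "complex_of_real (max 0 (1 - (real (plen z) - real (plen v)) / real (Suc n)))"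
        let ?t = "\<lambda>w. if w \<odot> v = z then c n w * (complex_of_real (lam v w) * f v) else 0"
        show "sum ?t ?F = ?k * A (\<xi> v) z * f v"
        proof (cases "\<exists>w\<in>?P. w \<odot> v = z")
          case True
          then obtain w where w: "w \<in> ?P" "w \<odot> v = z" by blast
          have unique: "w' = w" if "w' \<in> ?P" "w' \<odot> v = z" for w'
            by (rule pcomp_cancel_right[OF that(1) w(1) v]) (use that w z in auto)
          have "src w = rng v"
            using w v z pcomp_in_dpaths_iff by metis
          then have entry: "A (\<xi> v) z = a w * complex_of_real (lam v w)"
            using coeff[OF v w(1)] w(2) by simp
          have plen_z: "plen z = plen w + plen v"
            using w(2) by auto
          have k: "c n w = ?k * a w"
            by (simp add: c_def plen_z)
          show ?thesis
          proof (cases "plen w \<le> n")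
            case True
            have "sum ?t ?F = sum ?t {w}"
            proof (rule sum.mono_neutral_right[OF finite_levels])
              show "\<forall>w'\<in>?F - {w}. ?t w' = 0"
                using unique by (intro ballI if_not_P) blast
            qed (use w True in simp)
            then show ?thesis
              using w(2) by (simp add: k entry)
          next
            case False
            then have "real (Suc n) \<le> real (plen w)" by simp
            then have "?k = 0"
              by (simp add: plen_z)
            moreover have "sum ?t ?F = 0"
              using unique False by (intro sum.neutral ballI if_not_P) blast
            ultimately show ?thesis by simp
          qed
        next
          case False
          then have "A (\<xi> v) z = 0"
            using zero[OF v z] by blast
          moreover have "sum ?t ?F = 0"
            by (rule sum.neutral) (use False in auto)
          ultimately show ?thesis by simp
        qed
      qed
      finally show ?thesis
        using z by (simp add: fejer_mean_def)
    qed
  qed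
  have "A \<in> \<A>" if L\<A>: "L ` ?P \<subseteq> \<A>" and \<A>: "unital_operator_algebra ?P \<A>"
    and cl: "closedin (weak_operator_topology_on ?P) \<A>" for \<A>
  proof (rule closedin_weak_operator_sequentially[OF cl _ A])
    show "B n \<in> \<A>" for n
      unfolding B_def by (rule unital_operator_algebra_sum[OF \<A> finite_levels]) (use L\<A> in auto)
  next
    fix f g assume "f \<in> l2 ?P" "g \<in> l2 ?P"
    then show "(\<lambda>n. l2_inner ?P (B n f) g) \<longlonglongrightarrow> l2_inner ?P (A f) g"
      using fejer_mean_weakly_tendsto by (simp add: B_eq)
  qed
  then show ?thesis
    by (auto simp: weighted_graph_algebra_def wot_closed_algebra_generated_def finite_weight_lam hull_def)
qed

lemma double_commutant_eq:
  assumes "\<forall>v\<in>dpaths G. \<exists>u\<in>finite_weight_paths G rho. v \<odot> u \<in> finite_weight_paths G rho"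
  shows "commutant (dpaths G) (commutant (dpaths G) (\<LL> G lam)) = \<LL> G lam"
proof
  show "commutant (dpaths G) (commutant (dpaths G) (\<LL> G lam)) \<subseteq> \<LL> G lam"
  proof
    fix A assume "A \<in> commutant (dpaths G) (commutant (dpaths G) (\<LL> G lam))"
    then have A: "A \<in> bounded_ops (dpaths G)"
      and comm: "\<And>u. u \<in> finite_weight_paths G rho \<Longrightarrow>
        op_mult (dpaths G) A (R u) = op_mult (dpaths G) (R u) A"
      using R_in_commutant unfolding commutant_def[of _ "commutant _ _"] by blast+
    show "A \<in> \<LL> G lam"
      by (rule in_algebra_of_matrix[OF A]) (rule matrix_of_double_commutant[OF assms A comm]; simp)+
  qed
qed (rule algebra_in_double_commutant)

text \<open>Commutation with \<open>L w\<close> gives \<open>T (\<xi> w)\<close> from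
  \<open>T (\<xi> s)\<close> for the common source \<open>s\<close>, so the entry at
  \<open>(w, w \<odot> u)\<close> is \<open>t * lam u w / lam s w\<close>. The companion identity
  turns this quotient into \<open>rho w u / rho s u\<close>, and the entries of \<open>T\<close> are
  bounded.\<close>

lemma commutant_entry:
  assumes T: "T \<in> commutant (dpaths G) (\<LL> G lam)"
    and v: "v \<in> dpaths G" and z: "z \<in> dpaths G" and nz: "T (\<xi> v) z \<noteq> 0"
  obtains u where "u \<in> finite_weight_paths G rho" "v \<odot> u = z"
proof -
  have Tb: "T \<in> bounded_ops (dpaths G)"
    using T by (simp add: commutant_def)
  define s where "s = (vpath (src v) :: ('v, 'e) dpath)"
  have s: "s \<in> dpaths G" "rng s = src v"
    using v by (simp_all add: s_def src_in_verts)
  note Ts = bounded_ops_in_l2[OF Tb basis_vec_in_l2[OF s(1)]]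
  have key: "complex_of_real (lam s w) * T (\<xi> w) z' = L w (T (\<xi> s)) z'"
    if w: "w \<in> dpaths G" "src w = src v" for w z'
  proof -
    have ws: "w \<odot> s = w"
      using pcomp_vpath_src[of w] w(2) by (simp add: s_def)
    have "T (L w (\<xi> s)) = L w (T (\<xi> s))"
      using T L_in_algebra[OF w(1)] basis_vec_in_l2[OF s(1)]
      unfolding commutant_def by (auto simp: op_mult_eq_iff)
    moreover have "L w (\<xi> s) = (\<lambda>i. complex_of_real (lam s w) * \<xi> w i)"
      using w(1) by (simp add: weighted_shift_basis[OF s(1) w(1)] ws)
    ultimately show ?thesis
      using bounded_ops_scale[OF Tb basis_vec_in_l2[OF w(1)]] by metis
  qed
  have "L v (T (\<xi> s)) z \<noteq> 0"
    using key[OF v refl, of z] nz lam_pos[OF s(1) v] s(2) by auto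
  then obtain u where u: "u \<in> dpaths G" "v \<odot> u = z"
    using weighted_shift_eq_0[OF Ts, of v z lam] by blast
  then have vu: "v \<odot> u \<in> dpaths G" "src v = rng u"
    using z v pcomp_in_dpaths_iff by metis+
  define t where "t = T (\<xi> s) u"
  have "t \<noteq> 0"
    using \<open>L v (T (\<xi> s)) z \<noteq> 0\<close> weighted_shift_pcomp[OF Ts u(1) v vu(1), of lam] u(2) by (auto simp: t_def)
  obtain K where K: "0 \<le> K" "\<forall>f\<in>l2 (dpaths G). \<forall>F. finite F \<longrightarrow> F \<subseteq> dpaths G \<longrightarrow>
      (\<Sum>i\<in>F. (cmod (T f i))\<^sup>2) \<le> K * (l2_norm (dpaths G) f)\<^sup>2"
    using bounded_ops_bound[OF Tb] by blast
  have norm_xi: "(l2_norm (dpaths G) (\<xi> w))\<^sup>2 \<le> 1" for w :: "('v, 'e) dpath"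
  proof (cases "w \<in> dpaths G")
    case True
    show ?thesis
    proof (rule l2_boundI(2))
      fix F :: "('v, 'e) dpath set" assume "finite F"
      then have "(\<Sum>i\<in>F. (cmod (\<xi> w i))\<^sup>2) = (\<Sum>i\<in>F \<inter> {w}. (cmod (\<xi> w i))\<^sup>2)"
        by (intro sum.mono_neutral_right) (auto simp: basis_vec_def)
      also have "\<dots> \<le> 1"
        by (cases "w \<in> F") (simp_all add: basis_vec_def)
      finally show "(\<Sum>i\<in>F. (cmod (\<xi> w i))\<^sup>2) \<le> 1" .
    qed (use True in \<open>auto simp: basis_vec_def\<close>)
  next
    case False
    then have "(\<Sum>\<^sub>\<infinity>i\<in>dpaths G. (cmod (\<xi> w i))\<^sup>2) = 0"
      by (intro infsum_0) (auto simp: basis_vec_def)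
    then show ?thesis by (simp add: l2_norm_def)
  qed
  \<comment> \<open>\<open>K\<close> bounds the squared norm of \<open>T\<close>, hence the root;
    dividing by \<open>cmod t\<close> is where the nonzero entry is used.\<close>
  have "rho w u \<le> rho s u * sqrt K / cmod t" if w: "w \<in> dpaths G" for w
  proof (cases "src w = rng u")
    case False
    then show ?thesis
      using rho_eq_0[OF w u(1)] rho_nonneg[OF s(1) u(1)] K(1) by simp
  next
    case True
    have wu: "w \<odot> u \<in> dpaths G" and wv: "src w = src v"
      using w u(1) True vu(2) by (simp_all add: pcomp_in_dpaths_iff)
    have su: "s \<odot> u = u" "w \<odot> s = w"
      using vpath_rng_pcomp[of u] pcomp_vpath_src[of w] vu(2) wv by (simp_all add: s_def)
    have "complex_of_real (lam s w) * T (\<xi> w) (w \<odot> u) = complex_of_real (lam u w) * t"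
      using key[OF w wv] weighted_shift_pcomp[OF Ts u(1) w wu] by (simp add: t_def)
    moreover have "lam s w * cmod (T (\<xi> w) (w \<odot> u)) = cmod (complex_of_real (lam s w) * T (\<xi> w) (w \<odot> u))"
      using lam_pos[OF s(1) w] s(2) wv by (simp add: norm_mult)
    moreover have "cmod (complex_of_real (lam u w) * t) = lam u w * cmod t"
      using lam_pos[OF u(1) w True] by (simp add: norm_mult)
    ultimately have lam_t: "lam s w * cmod (T (\<xi> w) (w \<odot> u)) = lam u w * cmod t"
      by simp
    have "rho w u * lam s w = lam u w * rho s u"
      using rho_lam[OF s(1) w u(1)] s vu(2) wv su by (simp add: s_def)
    then have "lam s w * (rho w u * cmod t) = lam s w * (rho s u * cmod (T (\<xi> w) (w \<odot> u)))"
      using lam_t by (metis mult.assoc mult.commute)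
    then have "rho w u * cmod t = rho s u * cmod (T (\<xi> w) (w \<odot> u))"
      using lam_pos[OF s(1) w] s(2) wv by simp
    moreover have "(cmod (T (\<xi> w) (w \<odot> u)))\<^sup>2 \<le> K * (l2_norm (dpaths G) (\<xi> w))\<^sup>2"
      using K(2)[rule_format, OF basis_vec_in_l2[OF w], of "{w \<odot> u}"] wu by simp
    then have "(cmod (T (\<xi> w) (w \<odot> u)))\<^sup>2 \<le> K"
      using mult_left_mono[OF norm_xi[of w] K(1)] by simp
    then have "cmod (T (\<xi> w) (w \<odot> u)) \<le> sqrt K"
      by (rule real_le_rsqrt)
    then have "rho s u * cmod (T (\<xi> w) (w \<odot> u)) \<le> rho s u * sqrt K"
      using rho_nonneg[OF s(1) u(1)] by (rule mult_left_mono)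
    ultimately show ?thesis
      using \<open>t \<noteq> 0\<close> by (simp add: le_divide_eq)
  qed
  then have "u \<in> finite_weight_paths G rho"
    using u(1) unfolding finite_weight_paths_iff by blast
  then show ?thesis using that u(2) by blast
qed

text \<open>The diagonal of \<open>L w\<close> at \<open>v\<close> is 1 if \<open>w\<close> is the
  vertex \<open>rng v\<close> and 0 otherwise. Constancy of diagonals survives products only because
  the diagonal is multiplicative on triangular matrices, so triangularity is carried along in the
  minimality argument.\<close>

lemma algebra_diagonal:
  assumes A: "A \<in> \<LL> G lam" and v: "v \<in> dpaths G"
  shows "A (\<xi> v) v = A (\<xi> (vpath (rng v))) (vpath (rng v))"
proof -
  let ?P = "dpaths G"
  \<comment> \<open>The pairs at which every \<open>L w\<close> has a zero entry. Off
    \<open>J\<close>, \<open>z\<close> extends \<open>v\<close> at its range end; this relation is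
    transitive, and mutual extension forces equality.\<close>
  define J where "J = {(v, z). v \<in> ?P \<and> z \<in> ?P \<and> (\<forall>w\<in>?P. w \<odot> v \<noteq> z)}"
  define \<T> where "\<T> = {A \<in> bounded_ops ?P. \<forall>(v, z)\<in>J. A (\<xi> v) z = 0}"
  define \<D> where "\<D> = {A \<in> bounded_ops ?P. \<forall>v\<in>?P. A (\<xi> v) v = A (\<xi> (vpath (rng v))) (vpath (rng v))}"
  have vp: "vpath (rng v) \<in> ?P" if "v \<in> ?P" for v
    using that by (simp add: rng_in_verts)
  have mult_diag: "B (A (\<xi> v)) v = A (\<xi> v) v * B (\<xi> v) v"
    if A: "A \<in> \<T>" and B: "B \<in> \<T>" and v: "v \<in> ?P" for A B v
  proof -
    have Ab: "A \<in> bounded_ops ?P" and Bb: "B \<in> bounded_ops ?P"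
      using A B by (simp_all add: \<T>_def)
    have "B (A (\<xi> v)) v = (\<Sum>t\<in>{v}. A (\<xi> v) t * B (\<xi> t) v)"
    proof (rule bounded_ops_finite_expansion[OF Bb bounded_ops_in_l2[OF Ab basis_vec_in_l2[OF v]]])
      fix t assume t: "t \<in> ?P - {v}"
      show "A (\<xi> v) t * B (\<xi> t) v = 0"
      proof (rule ccontr)
        assume "A (\<xi> v) t * B (\<xi> t) v \<noteq> 0"
        then have "(v, t) \<notin> J" "(t, v) \<notin> J"
          using A B by (auto simp: \<T>_def)
        then obtain w w' where w: "w \<in> ?P" "w \<odot> v = t" "w' \<in> ?P" "w' \<odot> t = v"
          using t v by (auto simp: J_def)
        \<comment> \<open>\<open>t\<close> extends \<open>v\<close> and \<open>v\<close> extends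
          \<open>t\<close>, so additivity of length leaves only a vertex for \<open>w\<close>, and
          \<open>t = v\<close>.\<close>
        then have "plen w = 0"
          by (metis add_is_0 add_cancel_left_left add.assoc plen_pcomp)
        then have "w \<odot> v = v"
          using w(1,2) t v pcomp_in_dpaths_iff[OF w(1) v]
          by (cases w; cases v) (auto simp: plen_def pcomp_def src_def rng_def dpaths_def awalk_Nil_iff)
        with w(2) t show False by simp
      qed
    qed (use v in auto)
    then show ?thesis by simp
  qed
  have mult_lower: "B (A (\<xi> v)) z = 0"
    if A: "A \<in> \<T>" and B: "B \<in> \<T>" and vz: "(v, z) \<in> J" for A B v z
  proof -
    have Ab: "A \<in> bounded_ops ?P" and Bb: "B \<in> bounded_ops ?P"
      using A B by (simp_all add: \<T>_def)
    have v: "v \<in> ?P" and z: "z \<in> ?P" using vz by (auto simp: J_def)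
    have "B (A (\<xi> v)) z = (\<Sum>t\<in>{}. A (\<xi> v) t * B (\<xi> t) z)"
    proof (rule bounded_ops_finite_expansion[OF Bb bounded_ops_in_l2[OF Ab basis_vec_in_l2[OF v]]])
      fix t assume t: "t \<in> ?P - {}"
      show "A (\<xi> v) t * B (\<xi> t) z = 0"
      proof (rule ccontr)
        assume "A (\<xi> v) t * B (\<xi> t) z \<noteq> 0"
        then have "(v, t) \<notin> J" "(t, z) \<notin> J"
          using A B by (auto simp: \<T>_def)
        then obtain w w' where w: "w \<in> ?P" "w \<odot> v = t" "w' \<in> ?P" "w' \<odot> t = z"
          using t v z by (auto simp: J_def)
        have "src w' = rng t"
          using pcomp_in_dpaths_iff[OF w(3), of t] w t z by simp
        then have "w' \<odot> w \<in> ?P"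
          using w pcomp_in_dpaths_iff[OF w(3,1)] by auto
        moreover have "(w' \<odot> w) \<odot> v = z"
          using w by (simp add: pcomp_assoc)
        ultimately show False
          using vz by (auto simp: J_def)
      qed
    qed auto
    then show ?thesis by simp
  qed
  have basis: "\<xi> v \<in> l2 ?P" if "v \<in> ?P" for v
    using that by (rule basis_vec_in_l2)
  have "\<LL> G lam \<subseteq> \<T> \<inter> \<D>"
  proof (rule algebra_minimal)
    fix w assume w: "w \<in> ?P"
    have "L w (\<xi> v) z = 0" if "(v, z) \<in> J" for v z
      using that w weighted_shift_basis[of v G w lam] by (auto simp: J_def basis_vec_def)
    then have "L w \<in> \<T>"
      using L_bounded[OF w] by (auto simp: \<T>_def)
    moreover have diag: "L w (\<xi> v) v = (if w = vpath (rng v) then 1 else 0)" if v: "v \<in> ?P" for v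
    proof (cases "w = vpath (rng v)")
      case True
      then show ?thesis
        using v lam_vpath[OF v] weighted_shift_basis[OF v w, of lam]
        by (simp add: vpath_rng_pcomp basis_vec_def)
    next
      case False
      then have "w \<odot> v \<noteq> v"
        using pcomp_eq_right[OF w v] by blast
      then show ?thesis
        using False weighted_shift_basis[OF v w, of lam] by (simp add: basis_vec_def)
    qed
    then have "L w \<in> \<D>"
      using L_bounded[OF w] diag[OF vp] by (auto simp: \<D>_def)
    ultimately show "L w \<in> \<T> \<inter> \<D>" by blast
  next
    show "closedin (weak_operator_topology_on ?P) (\<T> \<inter> \<D>)"
      unfolding \<T>_def \<D>_def
    proof (intro closedin_Int closedin_weak_operator_Inter)
      fix i assume i: "i \<in> J"
      obtain v z where vz: "i = (v, z)" "v \<in> ?P" "z \<in> ?P"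
        using i by (auto simp: J_def)
      show "closedin (weak_operator_topology_on ?P)
          {T \<in> bounded_ops ?P. case i of (v, z) \<Rightarrow> T (\<xi> v) z = 0}"
        unfolding vz(1) prod.case
        by (rule closedin_weak_operator_eq[OF continuous_map_weak_operator_entry[OF basis[OF vz(2)] vz(3)]]) simp
    next
      fix v assume v: "v \<in> ?P"
      show "closedin (weak_operator_topology_on ?P)
          {T \<in> bounded_ops ?P. T (\<xi> v) v = T (\<xi> (vpath (rng v))) (vpath (rng v))}"
        using closedin_weak_operator_eq[OF continuous_map_weak_operator_entry[OF basis[OF v] v]
          continuous_map_weak_operator_entry[OF basis[OF vp[OF v]] vp[OF v]]] .
    qed
  next
    have TD: "A \<in> \<T> \<inter> \<D> \<longleftrightarrow> A \<in> bounded_ops ?P \<and> (\<forall>v z. (v, z) \<in> J \<longrightarrow> A (\<xi> v) z = 0) \<and>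
        (\<forall>v\<in>?P. A (\<xi> v) v = A (\<xi> (vpath (rng v))) (vpath (rng v)))" for A
      unfolding \<T>_def \<D>_def by blast
    have basis_J: "\<xi> v \<in> l2 ?P" if "(v, z) \<in> J" for v z
      using that basis by (simp add: J_def)
    have J_neq: "v \<noteq> z" if "(v, z) \<in> J" for v z
    proof -
      have "vpath (rng v) \<odot> v \<noteq> z"
        using that vp[of v] unfolding J_def by blast
      then show ?thesis by (simp add: vpath_rng_pcomp)
    qed
    have "op_id ?P (\<xi> v) z = 0" if "(v, z) \<in> J" for v z
      using J_neq[OF that] basis_J[OF that] by (simp add: op_id_def basis_vec_def[of v])
    moreover have "op_id ?P (\<xi> v) v = 1" if "v \<in> ?P" for v
      using basis[OF that] by (simp add: op_id_def basis_vec_def[of v])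
    ultimately have "op_id ?P \<in> \<T> \<inter> \<D>"
      unfolding TD using vp by (simp add: op_id_bounded)
    moreover have "op_add ?P A B \<in> \<T> \<inter> \<D>" if "A \<in> \<T> \<inter> \<D>" "B \<in> \<T> \<inter> \<D>" for A B
    proof -
      have add: "op_add ?P A B (\<xi> v) z = A (\<xi> v) z + B (\<xi> v) z" if "\<xi> v \<in> l2 ?P" for v z
        using that by (simp add: op_add_def)
      show ?thesis
        unfolding TD
      proof (intro conjI allI impI ballI)
        fix v assume v: "v \<in> ?P"
        have "A (\<xi> v) v = A (\<xi> (vpath (rng v))) (vpath (rng v))"
          "B (\<xi> v) v = B (\<xi> (vpath (rng v))) (vpath (rng v))"
          using that v unfolding TD by blast+
        then show "op_add ?P A B (\<xi> v) v = op_add ?P A B (\<xi> (vpath (rng v))) (vpath (rng v))"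
          unfolding add[OF basis[OF v]] add[OF basis[OF vp[OF v]]] by (rule arg_cong2)
      next
        fix v z assume vz: "(v, z) \<in> J"
        have "A (\<xi> v) z = 0" "B (\<xi> v) z = 0"
          using that vz unfolding TD by blast+
        then show "op_add ?P A B (\<xi> v) z = 0"
          by (simp add: add[OF basis_J[OF vz]])
      qed (use that op_add_bounded TD in blast)
    qed
    moreover have "op_scale ?P c A \<in> \<T> \<inter> \<D>" if "A \<in> \<T> \<inter> \<D>" for A c
    proof -
      have scale: "op_scale ?P c A (\<xi> v) z = c * A (\<xi> v) z" if "\<xi> v \<in> l2 ?P" for v z
        using that by (simp add: op_scale_def)
      show ?thesis
        unfolding TD
      proof (intro conjI allI impI ballI)
        fix v assume v: "v \<in> ?P"
        have "A (\<xi> v) v = A (\<xi> (vpath (rng v))) (vpath (rng v))"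
          using that v unfolding TD by blast
        then show "op_scale ?P c A (\<xi> v) v = op_scale ?P c A (\<xi> (vpath (rng v))) (vpath (rng v))"
          unfolding scale[OF basis[OF v]] scale[OF basis[OF vp[OF v]]] by (rule arg_cong)
      next
        fix v z assume vz: "(v, z) \<in> J"
        have "A (\<xi> v) z = 0"
          using that vz unfolding TD by blast
        then show "op_scale ?P c A (\<xi> v) z = 0"
          by (simp add: scale[OF basis_J[OF vz]])
      qed (use that op_scale_bounded TD in blast)
    qed
    moreover have "op_mult ?P B A \<in> \<T> \<inter> \<D>" if A: "A \<in> \<T> \<inter> \<D>" and B: "B \<in> \<T> \<inter> \<D>" for A B
      unfolding TD
    proof (intro conjI allI impI ballI)
      have T: "A \<in> \<T>" "B \<in> \<T>" using A B by simp_all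
      fix v assume v: "v \<in> ?P"
      have "A (\<xi> v) v = A (\<xi> (vpath (rng v))) (vpath (rng v))"
        "B (\<xi> v) v = B (\<xi> (vpath (rng v))) (vpath (rng v))"
        using A B v unfolding TD by blast+
      then show "op_mult ?P B A (\<xi> v) v = op_mult ?P B A (\<xi> (vpath (rng v))) (vpath (rng v))"
        unfolding op_mult_apply[OF basis[OF v]] op_mult_apply[OF basis[OF vp[OF v]]]
          mult_diag[OF T v] mult_diag[OF T vp[OF v]] by (rule arg_cong2)
    next
      fix v z assume vz: "(v, z) \<in> J"
      show "op_mult ?P B A (\<xi> v) z = 0"
        unfolding op_mult_apply[OF basis_J[OF vz]] by (rule mult_lower[OF _ _ vz]) (use A B in simp_all)
    qed (use A B op_mult_bounded TD in blast)
    moreover have "\<T> \<inter> \<D> \<subseteq> bounded_ops ?P"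
      using TD by blast
    ultimately show "unital_operator_algebra ?P (\<T> \<inter> \<D>)"
      unfolding unital_operator_algebra_def by (intro conjI ballI allI)
  qed
  then show ?thesis
    using A v unfolding \<D>_def by blast
qed

text \<open>
  For a vertex \<open>a\<close>, \<open>R (vpath a)\<close> is the projection onto the span of the paths starting at \<open>a\<close>.  It
  violates the constancy of the diagonal along \<open>p\<close>, and it fails to commute only with those elements of
  the commutant that have a nonzero entry between paths with distinct sources.
\<close>

lemma double_commutant_eq_imp:
  assumes eq: "commutant (dpaths G) (commutant (dpaths G) (\<LL> G lam)) = \<LL> G lam"
    and p: "p \<in> dpaths G" "src p \<noteq> rng p"
  obtains u where "u \<in> finite_weight_paths G rho" "src u \<noteq> rng u"
proof -
  let ?P = "dpaths G"
  define a where "a = (vpath (rng p) :: ('v, 'e) dpath)"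
  have a: "a \<in> ?P" "a \<in> finite_weight_paths G rho"
    using p by (simp_all add: a_def rng_in_verts vpath_finite_weight)
  have Ra: "R a f z = (if src z = rng p then f z else 0)" if f: "f \<in> l2 ?P" and z: "z \<in> ?P" for f z
  proof (cases "src z = rng p")
    case True
    then have "z \<odot> a = z"
      using pcomp_vpath_src[of z] by (simp add: a_def)
    then show ?thesis
      using weighted_right_shift_pcomp[OF f z a(1), of rho] z True rho_vpath[OF z] by (simp add: a_def)
  next
    case False
    have "R a f z = 0"
      by (rule weighted_right_shift_eq_0[OF f]) (use False in \<open>auto simp: a_def\<close>)
    with False show ?thesis by simp
  qed
  have "R a \<notin> \<LL> G lam"
  proof
    assume "R a \<in> \<LL> G lam"
    from algebra_diagonal[OF this p(1)] have "R a (\<xi> p) p = R a (\<xi> a) a"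
      by (simp add: a_def)
    \<comment> \<open>The entry at \<open>p\<close> is 0, since \<open>p\<close> does not start at
      \<open>rng p\<close>, whereas the entry at the vertex \<open>a\<close> is 1.\<close>
    then show False
      using p a by (simp add: Ra basis_vec_in_l2) (simp add: a_def basis_vec_def)
  qed
  then have "R a \<notin> commutant ?P (commutant ?P (\<LL> G lam))"
    using eq by simp
  then obtain T where T: "T \<in> commutant ?P (\<LL> G lam)"
    and ne: "op_mult ?P (R a) T \<noteq> op_mult ?P T (R a)"
    using R_bounded[OF a(2)] unfolding commutant_def[of _ "commutant _ _"] by blast
  have Tb: "T \<in> bounded_ops ?P"
    using T by (simp add: commutant_def)
  have "\<exists>v\<in>?P. \<exists>z\<in>?P. T (\<xi> v) z \<noteq> 0 \<and> src v \<noteq> src z"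
  proof (rule ccontr)
    assume block: "\<not> ?thesis"
    have "op_mult ?P (R a) T = op_mult ?P T (R a)"
    proof (rule bounded_ops_eqI)
      fix v z assume v: "v \<in> ?P" and z: "z \<in> ?P"
      note b = basis_vec_in_l2[OF v]
      have "R a (\<xi> v) = (if src v = rng p then \<xi> v else (\<lambda>_. 0))"
        using weighted_right_shift_basis[OF v a(1), of rho] v a rho_vpath[OF v] pcomp_vpath_src[of v]
        by (auto simp: pcomp_in_dpaths_iff a_def)
      then have "T (R a (\<xi> v)) z = (if src v = rng p then T (\<xi> v) z else 0)"
        using bounded_ops_zero[OF Tb] by simp
      also have "\<dots> = R a (T (\<xi> v)) z"
      proof -
        have "T (\<xi> v) z = 0 \<or> src v = src z"
          using block v z by blast
        then show ?thesis
          using Ra[OF bounded_ops_in_l2[OF Tb b] z] by auto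
      qed
      finally show "op_mult ?P (R a) T (\<xi> v) z = op_mult ?P T (R a) (\<xi> v) z"
        by (simp add: op_mult_apply b)
    qed (use Tb R_bounded[OF a(2)] op_mult_bounded in auto)
    with ne show False by simp
  qed
  then obtain v z where vz: "v \<in> ?P" "z \<in> ?P" "T (\<xi> v) z \<noteq> 0" "src v \<noteq> src z" by blast
  obtain u where u: "u \<in> finite_weight_paths G rho" "v \<odot> u = z"
    using commutant_entry[OF T vz(1-3)] by blast
  have uP: "u \<in> ?P" using u(1) by (simp add: finite_weight_paths_def)
  have "v \<odot> u \<in> ?P" using u(2) vz(2) by simp
  then have "src v = rng u"
    using pcomp_in_dpaths_iff[OF vz(1) uP] by simp
  moreover have "src z = src u" using u(2) by auto
  ultimately show ?thesis
    using that[OF u(1)] vz(4) by simp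
qed

text \<open>
  When paths are determined by source and length, \<open>w \<odot> c = c' \<odot> w\<close> for a path \<open>c'\<close> with the length
  of \<open>c\<close>, so that \<open>\<lambda>(c, w) / \<lambda>(a, w)\<close>, and with it \<open>\<rho>(w, c)\<close>, is controlled by the finitely many bounds \<open>\<lambda>(c')\<close>.
\<close>

lemma closed_path_finite_weight:
  assumes det: "\<And>v w. v \<in> dpaths G \<Longrightarrow> w \<in> dpaths G \<Longrightarrow> src v = src w \<Longrightarrow> plen v = plen w \<Longrightarrow> v = w"
    and c: "c \<in> dpaths G" "src c = rng c"
  shows "c \<in> finite_weight_paths G rho"
proof -
  let ?P = "dpaths G" and ?C = "{w \<in> dpaths G. plen w = plen c}"
  obtain M where M: "\<And>w v. w \<in> ?P \<Longrightarrow> v \<in> ?P \<Longrightarrow> lam v w \<le> M w"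
    using lam_bounded by metis
  define m where "m = (\<Sum>w\<in>?C. \<bar>M w\<bar>)"
  have m: "lam v w \<le> m" if "v \<in> ?P" "w \<in> ?C" for v w
  proof -
    have "lam v w \<le> \<bar>M w\<bar>"
      using M[of w v] that by simp
    also have "\<dots> \<le> m"
      unfolding m_def using finite_dpaths_plen that(2) by (intro member_le_sum) auto
    finally show ?thesis .
  qed
  define a where "a = (vpath (src c) :: ('v, 'e) dpath)"
  have a: "a \<in> ?P" "c \<odot> a = c" "a \<odot> c = c" "rng a = src c" "src a = src c"
    using c pcomp_vpath_src[of c] vpath_rng_pcomp[of c] src_in_verts[OF c(1)] by (simp_all add: a_def)
  have ac: "0 < lam a c"
    using lam_pos[OF a(1) c(1)] a by simp
  have ra: "0 \<le> rho a c"
    using rho_nonneg[OF a(1) c(1)] .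
  have m0: "0 \<le> m"
    unfolding m_def by (intro sum_nonneg) simp
  have "rho w c \<le> m * rho a c / lam a c" if w: "w \<in> ?P" for w
  proof (cases "src w = rng c")
    case False
    then show ?thesis
      using rho_eq_0[OF w c(1)] m0 ra ac by simp
  next
    case True
    then have wc: "w \<odot> c \<in> ?P"
      using w c by (simp add: pcomp_in_dpaths_iff)
    \<comment> \<open>Cut \<open>w \<odot> c\<close> after \<open>plen w\<close> arcs. As
      \<open>c\<close> is closed, the initial segment has the source and length of \<open>w\<close>,
      hence is \<open>w\<close>, and the rest \<open>c'\<close> has the length of
      \<open>c\<close>.\<close>
    obtain w' c' where *: "w' \<in> ?P" "c' \<in> ?P" "w \<odot> c = c' \<odot> w'" "plen w' = plen w"
      by (rule dpath_split[OF wc, of "plen w"], simp, blast)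
    have "src w' = src (w \<odot> c)" using *(3) by simp
    then have "w' = w"
      using det[OF *(1) w _ *(4)] True c(2) by simp
    note eq = *(3)[unfolded this]
    have c': "c' \<in> ?C"
      using *(2) arg_cong[OF eq, of plen] by simp
    have c'w: "src c' = rng w"
      using eq wc pcomp_in_dpaths_iff[OF *(2) w] by simp
    have wa: "w \<odot> a = w"
      using pcomp_vpath_src[of w] True c(2) by (simp add: a_def)
    \<comment> \<open>The weight of the same path at the vertex \<open>a\<close> is computed from
      both factorisations, \<open>w \<odot> c\<close> and \<open>c' \<odot> w\<close>. This trades
      the unknown growth of \<open>lam c w / lam a w\<close> for the bounded
      \<open>lam w c'\<close>.\<close>
    have "lam c w * lam a c = lam a (w \<odot> c)"
      using lam_pcomp[OF a(1) c(1) w] True a by simp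
    also have "\<dots> = lam w c' * lam a w"
      using lam_pcomp[OF a(1) w *(2) c'w] True c(2) a wa by (simp add: eq)
    finally have l: "lam c w * lam a c = lam w c' * lam a w" .
    have aw: "0 < lam a w"
      using lam_pos[OF a(1) w] a True c(2) by simp
    have "rho w c * lam a w = lam c w * rho a c"
      using rho_lam[OF a(1) w c(1)] a wa True c(2) by simp
    then have "lam a w * (rho w c * lam a c) = lam a w * (lam w c' * rho a c)"
      using l by (metis mult.assoc mult.commute)
    then have "rho w c * lam a c = lam w c' * rho a c"
      using aw by simp
    also have "\<dots> \<le> m * rho a c"
      using m[OF w c'] ra by (rule mult_right_mono)
    finally show ?thesis
      using ac by (simp add: le_divide_eq)
  qed
  then show ?thesis
    using c(1) unfolding finite_weight_paths_iff by blast
qed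

end

section \<open>The two-cycle\<close>

theorem mainTheorem5:
  fixes G :: "('v, 'e) pre_digraph"
    and x y :: 'v and e f :: 'e
    and lam rho :: "('v, 'e) weight"
  assumes "verts G = {x, y}" and "x \<noteq> y"
    and "arcs G = {e, f}" and "e \<noteq> f"
    and "tail G e = x" and "head G f = x"
    and "tail G f = y" and "head G e = y"
    and "left_weight G lam" and "left_bounded G lam"
    and "right_companion G lam rho"
  shows "commutant (dpaths G) (commutant (dpaths G) (\<LL> G lam)) = \<LL> G lam \<longleftrightarrow>
    (\<forall>v\<in>dpaths G. \<exists>u\<in>finite_weight_paths G rho. v \<odot> u \<in> finite_weight_paths G rho)"
proof -
  interpret companion_weights G lam rho
    by unfold_locales (use assms in auto)
  have awalk_det: "p = q"
    if "awalk a p b" "awalk a q c" "length p = length q" for a b c p q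
    using that
  proof (induction p arbitrary: a q)
    case Nil
    then show ?case by simp
  next
    case (Cons g p)
    then obtain h q' where q: "q = h # q'" by (cases q) auto
    \<comment> \<open>Each vertex emits exactly one arc, so two walks from the same vertex start
      with the same arc.\<close>
    have "g = h"
      using Cons.prems assms(2-8) unfolding q awalk_Cons_iff by auto
    then show ?case
      using Cons unfolding q awalk_Cons_iff by auto
  qed
  have det: "v = w" if vw: "v \<in> dpaths G" "w \<in> dpaths G" "src v = src w" "plen v = plen w" for v w
  proof -
    obtain a p b where v: "v = (a, p, b)" by (cases v)
    obtain c q d where w: "w = (c, q, d)" by (cases w)
    have *: "awalk a p b" "awalk a q d" "a = c" "length p = length q"
      using vw by (simp_all add: v w dpaths_def src_def plen_def)
    have "p = q"
      by (rule awalk_det[OF *(1,2,4)])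
    moreover have "awlast a p = b" "awlast a q = d"
      using *(1,2) unfolding awalk_conv by blast+
    ultimately show ?thesis
      using *(3) by (simp add: v w)
  qed
  have closed: "c \<in> finite_weight_paths G rho" if "c \<in> dpaths G" "src c = rng c" for c
    by (rule closed_path_finite_weight[OF _ that]) (rule det)
  have edges: "(x, [e], y) \<in> dpaths G" "(y, [f], x) \<in> dpaths G"
    using assms by (simp_all add: dpaths_def awalk_Cons_iff awalk_Nil_iff)
  have path: "\<exists>g\<in>dpaths G. src g = a \<and> rng g = b" if ab: "a \<in> {x, y}" "b \<in> {x, y}" "a \<noteq> b" for a b
  proof -
    consider "a = x" "b = y" | "a = y" "b = x"
      using ab by blast
    then show ?thesis
      using edges by cases (force simp: src_def rng_def)+
  qed
  have two: "src w \<in> {x, y}" "rng w \<in> {x, y}" if "w \<in> dpaths G" for w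
    using src_in_verts[OF that] rng_in_verts[OF that] assms(1) by simp_all
  show ?thesis
  proof
    assume eq: "commutant (dpaths G) (commutant (dpaths G) (\<LL> G lam)) = \<LL> G lam"
    obtain u where u: "u \<in> finite_weight_paths G rho" "src u \<noteq> rng u"
      by (rule double_commutant_eq_imp[OF eq edges(1)], simp add: src_def rng_def assms(2), blast)
    have uP: "u \<in> dpaths G" using u(1) by (simp add: finite_weight_paths_def)
    show "\<forall>v\<in>dpaths G. \<exists>u\<in>finite_weight_paths G rho. v \<odot> u \<in> finite_weight_paths G rho"
    proof
      fix v assume v: "v \<in> dpaths G"
      consider "src v = rng v" | "src v \<noteq> rng v" "src v = rng u" "rng v = src u"
        | "src v \<noteq> rng v" "src v = src u" "rng v = rng u"
        using two[OF v] two[OF uP] u(2) unfolding insert_iff empty_iff by metis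
      then show "\<exists>u\<in>finite_weight_paths G rho. v \<odot> u \<in> finite_weight_paths G rho"
      proof cases
        case 1
        have "v \<odot> vpath (src v) \<in> finite_weight_paths G rho"
          unfolding pcomp_vpath_src by (rule closed[OF v 1])
        then show ?thesis
          by (rule bexI) (rule vpath_finite_weight[OF src_in_verts[OF v]])
      next
        case 2
        \<comment> \<open>\<open>u\<close> runs opposite to \<open>v\<close>, so the product is a
          closed path.\<close>
        then have "v \<odot> u \<in> finite_weight_paths G rho"
          using uP v by (intro closed) (simp_all add: pcomp_in_dpaths_iff)
        then show ?thesis
          using u(1) by (rule bexI)
      next
        case 3
        \<comment> \<open>\<open>u\<close> runs parallel to \<open>v\<close>, and an edge
          \<open>g\<close> leads back. The witness is \<open>g \<odot> u\<close>: it is closed, and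
          \<open>v \<odot> g \<odot> u\<close> is the product of the closed path
          \<open>v \<odot> g\<close> with \<open>u\<close>, both of finite right weight.\<close>
        obtain g where g: "g \<in> dpaths G" "src g = rng u" "rng g = src u"
          using path[OF two(2,1)[OF uP]] u(2) by metis
        have "g \<odot> u \<in> finite_weight_paths G rho" "v \<odot> g \<in> finite_weight_paths G rho"
          using g uP v 3 by (intro closed; simp add: pcomp_in_dpaths_iff)+
        moreover from this(2) have "v \<odot> g \<odot> u \<in> finite_weight_paths G rho"
          using pcomp_finite_weight[of "v \<odot> g" u] u(1) g(2) by (simp add: pcomp_assoc)
        ultimately show ?thesis by blast
      qed
    qed
  qed (rule double_commutant_eq)
qed

end
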